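(* The modified Einstein frame generalised Einstein equations $$\hat\Box_{\mathrm{Hd}}B=d^*\bar H+\tfrac{4}{d-2}i_\xi H,\qquad \widehat{\mathrm{Rc}}=\tfrac1{d-2}\Big[\xi\otimes\xi-\tfrac{e^{-4\kappa\phi}}6|H|_g^2\,g\Big]+e^{-4\kappa\phi}\tfrac{H^2}{4},\qquad \Box\phi=-\tfrac{e^{-4\kappa\phi}}6|H|_g^2,$$ for the unknowns $(g,B,\phi)$, where $H=\bar H+dB$ and $\xi=d\phi$, form a quasi-linear hyperbolic system with principal symbol given by $g^{\mu\nu}$. Furthermore, writing the system in local coordinates $(x^\mu)=(t,x)$ as $g^{\mu\nu}\partial_\mu\partial_\nu u-f[u]=0$ with $u=(g_{\mu\nu},B_{\mu\nu},\phi)$, the non-linearity $f[u](t,x)$ vanishes if all of the following expressions are set to vanish at $(t,x)$: - $\partial_\alpha g_{\mu\nu}$, $B_{\mu\nu}$, $\partial_\alpha B_{\mu\nu}$, $\phi$ and $\partial_\alpha\phi$; - $\bar H_{\mu\nu\lambda}$, $\partial_\alpha\bar H_{\mu\nu\lambda}$, $\partial_\alpha\bar g_{\mu\nu}$ and $\partial_\alpha\partial_\beta\bar g_{\mu\nu}$. In particular, in local coordinates the system is of the form $g^{\mu\nu}\partial_\mu\partial_\nu u=f[u]$ with $u=(g,u')$, $u'=(B,\phi)$, where $$f[u](t,x)=F\big(g_{\mu\nu},u'_j,\partial_\mu u_j,\partial^\alpha \mathsf B_l(t,x)\big)$$ for finitely many smooth real-valued background functions $\mathsf B_l$ on the coordinate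 domain, with multi-indices $\alpha$ up to some finite order, and a smooth vector-valued function $F$, defined for Lorentzian $(g_{\mu\nu})$ and arbitrary real values of the other arguments, such that $F(g_{\mu\nu},0,\dots,0)=0$.
   Context: $M$ is a manifold of dimension $d=n+1\ge3$, $\kappa=\frac1{d-2}$. Fixed background fields: a Lorentzian metric $\bar g$ and a closed three-form $\bar H$ on $M$. Unknowns: a Lorentzian metric $g$, a two-form $B$ and a function $\phi$. $\nabla,\Gamma$ and $\bar\nabla,\bar\Gamma$ denote Levi-Civita connections and Christoffel symbols of $g$ and $\bar g$. Notation (all with respect to $g$ unless barred): $(d^*A)_{\mu_2\dots\mu_p}=-\nabla^\lambda A_{\lambda\mu_2\dots\mu_p}$; $i_\xi$ is the interior product with $\xi^\sharp$; $\Box=\nabla^\mu\nabla_\mu$; $H^2_{\mu\nu}=g^{\kappa\lambda}g^{\omega\pi}H_{\mu\kappa\omega}H_{\nu\lambda\pi}$; $|H|_g^2=H_{\mu\nu\lambda}H^{\mu\nu\lambda}$. $\mathcal D_\nu=-g_{\nu\mu}g^{\alpha\beta}(\Gamma^\mu_{\alpha\beta}-\bar\Gamma^\mu_{\alpha\beta})$, $\widehat{\mathrm{Rc}}_{\mu\nu}=\mathrm{Rc}_{\mu\nu}+\nabla_{(\mu}\mathcal D_{\nu)}$ (normalised symmetrisation), $\mathcal C_\nu=-g^{\kappa\lambda}\bar\nabla_\kappa B_{\lambda\nu}$, and $\hat\Box_{\mathrm{Hd}}B=-d^*dB-d\mathcal C$. $f[u](t,x)$ abbreviates a smooth function of $(t,x)$,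 $u(t,x)$ and the first partial derivatives of $u$ at $(t,x)$. The principal symbol being $g^{\mu\nu}$ means that after multiplying each equation by a non-zero constant, the second-order terms in the unknowns are exactly $g^{\mu\nu}\partial_\mu\partial_\nu u$ componentwise. *)

theory Defs
  imports "HOL-Analysis.Analysis"
begin

section \<open>Smooth functions\<close>

text \<open>
  A point of \<open>'i \<Rightarrow> real\<close> assigns a value to every variable of a family indexed by
  \<open>'i\<close>; the topology is the product topology.  \<open>Ck\<close> is meant for open sets \<open>W\<close>: all
  partial derivatives up to order \<open>k\<close> exist and are continuous.
\<close>

primrec Ck :: "nat \<Rightarrow> ('i \<Rightarrow> real) set \<Rightarrow> (('i \<Rightarrow> real) \<Rightarrow> real) \<Rightarrow> bool" where
  "Ck 0 W F \<longleftrightarrow> continuous_on W F"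
| "Ck (Suc k) W F \<longleftrightarrow> continuous_on W F \<and>
     (\<forall>i. (\<forall>v\<in>W. (\<lambda>t. F (v(i := t))) differentiable (at (v i))) \<and>
          Ck k W (\<lambda>v. deriv (\<lambda>t. F (v(i := t))) (v i)))"

text \<open>
  Smoothness on a set that need not be open (such as a set of symmetric matrices): a smooth
  extension to an open neighbourhood exists.
\<close>

definition smooth_vars_on :: "('i \<Rightarrow> real) set \<Rightarrow> (('i \<Rightarrow> real) \<Rightarrow> real) \<Rightarrow> bool" where
  "smooth_vars_on A F \<longleftrightarrow>
     (\<exists>W G. open W \<and> A \<subseteq> W \<and> (\<forall>k. Ck k W G) \<and> (\<forall>v\<in>A. F v = G v))"

definition smooth_on :: "(real^'n) set \<Rightarrow> (real^'n \<Rightarrow> real) \<Rightarrow> bool" where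
  "smooth_on U h \<longleftrightarrow> smooth_vars_on {v. (\<chi> i. v i) \<in> U} (\<lambda>v. h (\<chi> i. v i))"

definition pd :: "'n \<Rightarrow> (real^'n \<Rightarrow> real) \<Rightarrow> real^'n \<Rightarrow> real" where
  "pd i h x = deriv (\<lambda>t. h (x + t *\<^sub>R axis i 1)) 0"

text \<open>A multi-index is given by the list of its differentiation directions; its order is the length.\<close>

primrec pds :: "'n list \<Rightarrow> (real^'n \<Rightarrow> real) \<Rightarrow> real^'n \<Rightarrow> real" where
  "pds [] h = h"
| "pds (i # \<alpha>) h = pd i (pds \<alpha> h)"


section \<open>Manifolds and tensor fields\<close>

text \<open>A chart is a coordinate domain together with its coordinate map.\<close>

type_synonym ('m, 'n) chart = "'m set \<times> ('m \<Rightarrow> real^'n)"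

definition is_chart :: "'m topology \<Rightarrow> ('m, 'n::finite) chart \<Rightarrow> bool" where
  "is_chart M c \<longleftrightarrow> openin M (fst c) \<and> open (snd c ` fst c) \<and>
     homeomorphic_map (subtopology M (fst c)) (top_of_set (snd c ` fst c)) (snd c)"

definition coord_change ::
    "('m, 'n) chart \<Rightarrow> ('m, 'n) chart \<Rightarrow> real^'n \<Rightarrow> real^'n" where
  "coord_change c' c y = snd c (inv_into (fst c') (snd c') y)"

definition smooth_manifold :: "'m topology \<Rightarrow> ('m, 'n::finite) chart set \<Rightarrow> bool" where
  "smooth_manifold M \<A> \<longleftrightarrow>
     Hausdorff_space M \<and>
     (\<exists>\<B>. countable \<B> \<and> (\<forall>V\<in>\<B>. openin M V) \<and>
        (\<forall>W p. openin M W \<and> p \<in> W \<longrightarrow> (\<exists>V\<in>\<B>. p \<in> V \<and> V \<subseteq> W))) \<and>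
     (\<forall>c\<in>\<A>. is_chart M c) \<and>
     (\<Union>c\<in>\<A>. fst c) = topspace M \<and>
     (\<forall>c\<in>\<A>. \<forall>c'\<in>\<A>. \<forall>i.
        smooth_on (snd c' ` (fst c \<inter> fst c')) (\<lambda>y. coord_change c' c y $ i))"

text \<open>
  Components of a covariant tensor in one coordinate system.  The list contains the tensor
  indices, so only lists whose length is the rank are relevant; a function has rank 0.
\<close>

type_synonym 'n components = "'n list \<Rightarrow> real^'n \<Rightarrow> real"

text \<open>
  A covariant tensor field of rank \<open>k\<close> on an open subset \<open>\<Omega>\<close> of the manifold is given by
  its components in each chart, related by the tensorial transformation law.
\<close>

definition tensor_field ::
    "('m, 'n::finite) chart set \<Rightarrow> 'm set \<Rightarrow> nat \<Rightarrow> (('m, 'n) chart \<Rightarrow> 'n components) \<Rightarrow> bool" where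
  "tensor_field \<A> \<Omega> k T \<longleftrightarrow>
     (\<forall>c\<in>\<A>. \<forall>is. length is = k \<longrightarrow> smooth_on (snd c ` (fst c \<inter> \<Omega>)) (T c is)) \<and>
     (\<forall>c\<in>\<A>. \<forall>c'\<in>\<A>. \<forall>p \<in> fst c \<inter> fst c' \<inter> \<Omega>. \<forall>js. length js = k \<longrightarrow>
        T c' js (snd c' p) =
          (\<Sum>is | length is = k.
             (\<Prod>l<k. pd (js ! l) (\<lambda>y. coord_change c' c y $ (is ! l)) (snd c' p)) *
             T c is (snd c p)))"

definition form_field ::
    "('m, 'n::finite) chart set \<Rightarrow> 'm set \<Rightarrow> nat \<Rightarrow> (('m, 'n) chart \<Rightarrow> 'n components) \<Rightarrow> bool" where
  "form_field \<A> \<Omega> k A \<longleftrightarrow> tensor_field \<A> \<Omega> k A \<and>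
     (\<forall>c\<in>\<A>. \<forall>x \<in> snd c ` (fst c \<inter> \<Omega>). \<forall>is i j. length is = k \<longrightarrow> i < j \<longrightarrow> j < k \<longrightarrow>
        A c (is[i := is ! j, j := is ! i]) x = - A c is x)"

text \<open>Signature \<open>(-,+,\<dots>,+)\<close>.\<close>

definition lorentzian :: "real^'n^'n \<Rightarrow> bool" where
  "lorentzian A \<longleftrightarrow> transpose A = A \<and>
     (\<exists>(P :: real^'n^'n) i0. invertible P \<and>
        transpose P ** A ** P = (\<chi> i j. if i = j then (if i = i0 then -1 else 1) else 0))"

definition gmat :: "'n components \<Rightarrow> real^'n \<Rightarrow> real^'n^'n" where
  "gmat g x = (\<chi> \<mu> \<nu>. g [\<mu>, \<nu>] x)"

definition lorentzian_metric ::
    "('m, 'n::finite) chart set \<Rightarrow> 'm set \<Rightarrow> (('m, 'n) chart \<Rightarrow> 'n components) \<Rightarrow> bool" where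
  "lorentzian_metric \<A> \<Omega> g \<longleftrightarrow> tensor_field \<A> \<Omega> 2 g \<and>
     (\<forall>c\<in>\<A>. \<forall>x \<in> snd c ` (fst c \<inter> \<Omega>). lorentzian (gmat (g c) x))"


section \<open>Tensor calculus in a coordinate system\<close>

definition ginv :: "'n::finite components \<Rightarrow> 'n \<Rightarrow> 'n \<Rightarrow> real^'n \<Rightarrow> real" where
  "ginv g \<mu> \<nu> x = matrix_inv (gmat g x) $ \<mu> $ \<nu>"

text \<open>\<open>christoffel g \<tau> \<mu> \<nu>\<close> has the upper index first.\<close>

definition christoffel :: "'n::finite components \<Rightarrow> 'n \<Rightarrow> 'n \<Rightarrow> 'n \<Rightarrow> real^'n \<Rightarrow> real" where
  "christoffel g \<tau> \<mu> \<nu> x = 1/2 * (\<Sum>\<sigma>\<in>UNIV. ginv g \<tau> \<sigma> x *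
     (pd \<mu> (g [\<nu>, \<sigma>]) x + pd \<nu> (g [\<mu>, \<sigma>]) x - pd \<sigma> (g [\<mu>, \<nu>]) x))"

text \<open>
  \<open>riemann g \<rho> \<sigma> \<mu> \<nu>\<close> is \<open>R\<^sup>\<rho>\<^sub>\<sigma>\<^sub>\<mu>\<^sub>\<nu>\<close>, with the sign for which round spheres
  have positive Ricci curvature.
\<close>

definition riemann :: "'n::finite components \<Rightarrow> 'n \<Rightarrow> 'n \<Rightarrow> 'n \<Rightarrow> 'n \<Rightarrow> real^'n \<Rightarrow> real" where
  "riemann g \<rho> \<sigma> \<mu> \<nu> x =
     pd \<mu> (christoffel g \<rho> \<nu> \<sigma>) x - pd \<nu> (christoffel g \<rho> \<mu> \<sigma>) x +
     (\<Sum>\<tau>\<in>UNIV. christoffel g \<rho> \<mu> \<tau> x * christoffel g \<tau> \<nu> \<sigma> x -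
             christoffel g \<rho> \<nu> \<tau> x * christoffel g \<tau> \<mu> \<sigma> x)"

definition ricci :: "'n::finite components \<Rightarrow> 'n \<Rightarrow> 'n \<Rightarrow> real^'n \<Rightarrow> real" where
  "ricci g \<mu> \<nu> x = (\<Sum>\<rho>\<in>UNIV. riemann g \<rho> \<mu> \<rho> \<nu> x)"

text \<open>
  Covariant derivative for connection coefficients \<open>\<Gamma>\<close>; the differentiation index is the
  first one, \<open>(\<nabla>A)\<^sub>\<mu>\<^sub>\<nu>\<^sub>\<dots> = \<nabla>\<^sub>\<mu> A\<^sub>\<nu>\<^sub>\<dots>\<close>.  The value at the empty index list is junk.
\<close>

fun nabla :: "('n \<Rightarrow> 'n \<Rightarrow> 'n \<Rightarrow> real^'n \<Rightarrow> real) \<Rightarrow> 'n::finite components \<Rightarrow> 'n components" where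
  "nabla \<Gamma> A [] x = 0"
| "nabla \<Gamma> A (\<mu> # is) x = pd \<mu> (A is) x -
     (\<Sum>j<length is. \<Sum>\<tau>\<in>UNIV. \<Gamma> \<tau> \<mu> (is ! j) x * A (is[j := \<tau>]) x)"

definition extd :: "'n::finite components \<Rightarrow> 'n components" where
  "extd A is x = (\<Sum>j<length is. (-1) ^ j * pd (is ! j) (A (take j is @ drop (Suc j) is)) x)"

definition codiff :: "'n::finite components \<Rightarrow> 'n components \<Rightarrow> 'n components" where
  "codiff g A is x =
     - (\<Sum>\<kappa>\<in>UNIV. \<Sum>\<tau>\<in>UNIV. ginv g \<kappa> \<tau> x * nabla (christoffel g) A (\<kappa> # \<tau> # is) x)"

definition interior :: "'n::finite components \<Rightarrow> 'n components \<Rightarrow> 'n components \<Rightarrow> 'n components" where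
  "interior g \<xi> A is x = (\<Sum>\<kappa>\<in>UNIV. \<Sum>\<tau>\<in>UNIV. ginv g \<kappa> \<tau> x * \<xi> [\<kappa>] x * A (\<tau> # is) x)"

definition box :: "'n::finite components \<Rightarrow> 'n components \<Rightarrow> 'n components" where
  "box g A is x = (\<Sum>\<mu>\<in>UNIV. \<Sum>\<nu>\<in>UNIV. ginv g \<mu> \<nu> x *
     nabla (christoffel g) (nabla (christoffel g) A) (\<mu> # \<nu> # is) x)"

definition Hsq :: "'n::finite components \<Rightarrow> 'n components \<Rightarrow> 'n \<Rightarrow> 'n \<Rightarrow> real^'n \<Rightarrow> real" where
  "Hsq g H \<mu> \<nu> x = (\<Sum>\<kappa>\<in>UNIV. \<Sum>\<tau>\<in>UNIV. \<Sum>\<omega>\<in>UNIV. \<Sum>\<pi>\<in>UNIV.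
     ginv g \<kappa> \<tau> x * ginv g \<omega> \<pi> x * H [\<mu>, \<kappa>, \<omega>] x * H [\<nu>, \<tau>, \<pi>] x)"

definition Hnorm2 :: "'n::finite components \<Rightarrow> 'n components \<Rightarrow> real^'n \<Rightarrow> real" where
  "Hnorm2 g H x = (\<Sum>\<mu>\<in>UNIV. \<Sum>\<nu>\<in>UNIV. \<Sum>\<tau>\<in>UNIV. \<Sum>\<alpha>\<in>UNIV. \<Sum>\<beta>\<in>UNIV. \<Sum>\<gamma>\<in>UNIV.
     ginv g \<mu> \<alpha> x * ginv g \<nu> \<beta> x * ginv g \<tau> \<gamma> x * H [\<mu>, \<nu>, \<tau>] x * H [\<alpha>, \<beta>, \<gamma>] x)"


section \<open>The modified Einstein frame equations\<close>

text \<open>The gauge covectors; \<open>hd is\<close> is their only index.\<close>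

definition gauge_D :: "'n::finite components \<Rightarrow> 'n components \<Rightarrow> 'n components" where
  "gauge_D gb g is x = - (\<Sum>\<mu>\<in>UNIV. \<Sum>\<alpha>\<in>UNIV. \<Sum>\<beta>\<in>UNIV.
     g [hd is, \<mu>] x * ginv g \<alpha> \<beta> x * (christoffel g \<mu> \<alpha> \<beta> x - christoffel gb \<mu> \<alpha> \<beta> x))"

definition gauge_C :: "'n::finite components \<Rightarrow> 'n components \<Rightarrow> 'n components \<Rightarrow> 'n components" where
  "gauge_C gb g B is x = - (\<Sum>\<kappa>\<in>UNIV. \<Sum>\<tau>\<in>UNIV.
     ginv g \<kappa> \<tau> x * nabla (christoffel gb) B [\<kappa>, \<tau>, hd is] x)"

definition ricci_hat :: "'n::finite components \<Rightarrow> 'n components \<Rightarrow> 'n \<Rightarrow> 'n \<Rightarrow> real^'n \<Rightarrow> real" where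
  "ricci_hat gb g \<mu> \<nu> x = ricci g \<mu> \<nu> x +
     1/2 * (nabla (christoffel g) (gauge_D gb g) [\<mu>, \<nu>] x +
            nabla (christoffel g) (gauge_D gb g) [\<nu>, \<mu>] x)"

definition box_Hd_hat :: "'n::finite components \<Rightarrow> 'n components \<Rightarrow> 'n components \<Rightarrow> 'n components" where
  "box_Hd_hat gb g B is x = - codiff g (extd B) is x - extd (gauge_C gb g B) is x"

definition field_strength :: "'n::finite components \<Rightarrow> 'n components \<Rightarrow> 'n components" where
  "field_strength Hb B is x = Hb is x + extd B is x"

text \<open>
  Labels of the components of \<open>u = (g, B, \<phi>)\<close>, and at the same time of the component
  equations: the \<open>\<mu>\<nu>\<close>-component of the Ricci equation carries the label \<open>G_comp \<mu> \<nu>\<close>, the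
  \<open>\<mu>\<nu>\<close>-component of the equation for \<open>B\<close> the label \<open>B_comp \<mu> \<nu>\<close>.
\<close>

datatype 'n unknown = G_comp 'n 'n | B_comp 'n 'n | Phi_comp

primrec u_comp :: "'n components \<Rightarrow> 'n components \<Rightarrow> 'n components \<Rightarrow> 'n unknown \<Rightarrow> real^'n \<Rightarrow> real" where
  "u_comp g B \<phi> (G_comp \<mu> \<nu>) = g [\<mu>, \<nu>]"
| "u_comp g B \<phi> (B_comp \<mu> \<nu>) = B [\<mu>, \<nu>]"
| "u_comp g B \<phi> Phi_comp = \<phi> []"

primrec system_lhs ::
    "'n::finite components \<Rightarrow> 'n components \<Rightarrow> 'n components \<Rightarrow> 'n components \<Rightarrow> 'n unknown \<Rightarrow>
     real^'n \<Rightarrow> real" where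
  "system_lhs gb g B \<phi> (G_comp \<mu> \<nu>) x = ricci_hat gb g \<mu> \<nu> x"
| "system_lhs gb g B \<phi> (B_comp \<mu> \<nu>) x = box_Hd_hat gb g B [\<mu>, \<nu>] x"
| "system_lhs gb g B \<phi> Phi_comp x = box g \<phi> [] x"

definition dilaton_factor :: "'n::finite components \<Rightarrow> real^'n \<Rightarrow> real" where
  "dilaton_factor \<phi> x = exp (- 4 * (1 / (real CARD('n) - 2)) * \<phi> [] x)"

primrec system_rhs ::
    "'n::finite components \<Rightarrow> 'n components \<Rightarrow> 'n components \<Rightarrow> 'n components \<Rightarrow> 'n unknown \<Rightarrow>
     real^'n \<Rightarrow> real" where
  "system_rhs Hb g B \<phi> (G_comp \<mu> \<nu>) x =
     1 / (real CARD('n) - 2) *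
       (extd \<phi> [\<mu>] x * extd \<phi> [\<nu>] x
        - dilaton_factor \<phi> x / 6 * Hnorm2 g (field_strength Hb B) x * g [\<mu>, \<nu>] x)
     + dilaton_factor \<phi> x * (Hsq g (field_strength Hb B) \<mu> \<nu> x / 4)"
| "system_rhs Hb g B \<phi> (B_comp \<mu> \<nu>) x =
     codiff g Hb [\<mu>, \<nu>] x
     + 4 / (real CARD('n) - 2) * interior g (extd \<phi>) (field_strength Hb B) [\<mu>, \<nu>] x"
| "system_rhs Hb g B \<phi> Phi_comp x =
     - (dilaton_factor \<phi> x / 6 * Hnorm2 g (field_strength Hb B) x)"


section \<open>The system in local coordinates\<close>

text \<open>
  All local component expressions, in the chart \<open>c\<close>, of unknowns \<open>(g, B, \<phi>)\<close> given on some
  open part \<open>\<Omega>\<close> of the manifold, paired with a coordinate point of their domain.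
\<close>

definition chart_unknowns ::
    "'m topology \<Rightarrow> ('m, 'n::finite) chart set \<Rightarrow> ('m, 'n) chart \<Rightarrow>
     ('n components \<times> 'n components \<times> 'n components \<times> (real^'n)) set" where
  "chart_unknowns M \<A> c = {(g c, B c, \<phi> c, x) | g B \<phi> x.
     \<exists>\<Omega>. openin M \<Omega> \<and> lorentzian_metric \<A> \<Omega> g \<and> form_field \<A> \<Omega> 2 B \<and> tensor_field \<A> \<Omega> 0 \<phi> \<and>
         x \<in> snd c ` (fst c \<inter> \<Omega>)}"

text \<open>The variables for the values and the first partial derivatives of \<open>u\<close>.\<close>

datatype 'n jet_var = Val "'n unknown" | Der 'n "'n unknown"

primrec jet ::
    "'n components \<Rightarrow> 'n components \<Rightarrow> 'n components \<Rightarrow> real^'n \<Rightarrow> 'n jet_var \<Rightarrow> real" where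
  "jet g B \<phi> x (Val k) = u_comp g B \<phi> k x"
| "jet g B \<phi> x (Der \<alpha> k) = pd \<alpha> (u_comp g B \<phi> k) x"

definition wave_part :: "'n::finite components \<Rightarrow> (real^'n \<Rightarrow> real) \<Rightarrow> real^'n \<Rightarrow> real" where
  "wave_part g h x = (\<Sum>\<mu>\<in>UNIV. \<Sum>\<nu>\<in>UNIV. ginv g \<mu> \<nu> x * pd \<mu> (pd \<nu> h) x)"

primrec eq_const :: "real \<Rightarrow> real \<Rightarrow> real \<Rightarrow> 'n unknown \<Rightarrow> real" where
  "eq_const a b c (G_comp \<mu> \<nu>) = a"
| "eq_const a b c (B_comp \<mu> \<nu>) = b"
| "eq_const a b c Phi_comp = c"

text \<open>
  The arguments of \<open>f\<close> are the coordinates (\<open>Inl\<close>) and the first jet of \<open>u\<close> (\<open>Inr\<close>); those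
  of \<open>F\<close> are the first jet of \<open>u\<close> (\<open>Inl\<close>) and the derivatives of the background functions
  (\<open>Inr (l, \<alpha>)\<close> for the derivative \<open>\<alpha>\<close> of the \<open>l\<close>-th one).  The variables for the components
  of \<open>B\<close> and for the derivatives of \<open>u\<close> are unrestricted, without (anti-)symmetry.
\<close>

definition f_domain :: "(real^'n) set \<Rightarrow> ('n + 'n jet_var \<Rightarrow> real) set" where
  "f_domain U = {v. (\<chi> i. v (Inl i)) \<in> U \<and>
     lorentzian (\<chi> \<mu> \<nu>. v (Inr (Val (G_comp \<mu> \<nu>))))}"

definition f_args ::
    "'n components \<Rightarrow> 'n components \<Rightarrow> 'n components \<Rightarrow> real^'n \<Rightarrow> 'n + 'n jet_var \<Rightarrow> real" where
  "f_args g B \<phi> x = case_sum (\<lambda>i. x $ i) (jet g B \<phi> x)"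

definition F_domain :: "('n::finite jet_var + nat \<times> 'n list \<Rightarrow> real) set" where
  "F_domain = {v. lorentzian (\<chi> \<mu> \<nu>. v (Inl (Val (G_comp \<mu> \<nu>))))}"

definition F_args ::
    "(nat \<Rightarrow> real^'n \<Rightarrow> real) \<Rightarrow> 'n components \<Rightarrow> 'n components \<Rightarrow> 'n components \<Rightarrow> real^'n \<Rightarrow>
     'n jet_var + nat \<times> 'n list \<Rightarrow> real" where
  "F_args b g B \<phi> x = case_sum (jet g B \<phi> x) (\<lambda>(l, \<alpha>). pds \<alpha> (b l) x)"

text \<open>
  \<open>f\<close> brings the system into the form \<open>g\<^sup>\<mu>\<^sup>\<nu>\<partial>\<^sub>\<mu>\<partial>\<^sub>\<nu> u - f[u] = 0\<close> in the chart \<open>c\<close>, after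
  multiplication of the component equation \<open>k\<close> by \<open>a k\<close>; hyperbolicity is the Lorentzian
  signature of the principal symbol \<open>g\<^sup>\<mu>\<^sup>\<nu>\<close>.
\<close>

definition quasilinear_hyperbolic_form ::
    "'m topology \<Rightarrow> ('m, 'n::finite) chart set \<Rightarrow> ('m, 'n) chart \<Rightarrow> 'n components \<Rightarrow> 'n components \<Rightarrow>
     ('n unknown \<Rightarrow> real) \<Rightarrow> (('n + 'n jet_var \<Rightarrow> real) \<Rightarrow> 'n unknown \<Rightarrow> real) \<Rightarrow> bool" where
  "quasilinear_hyperbolic_form M \<A> c gb Hb a f \<longleftrightarrow>
     (\<forall>k. a k \<noteq> 0) \<and>
     (\<forall>k. smooth_vars_on (f_domain (snd c ` fst c)) (\<lambda>v. f v k)) \<and>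
     (\<forall>(g, B, \<phi>, x) \<in> chart_unknowns M \<A> c.
        lorentzian (\<chi> \<mu> \<nu>. ginv g \<mu> \<nu> x) \<and>
        (\<forall>k. a k * (system_lhs gb g B \<phi> k x - system_rhs Hb g B \<phi> k x) =
             wave_part g (u_comp g B \<phi> k) x - f (f_args g B \<phi> x) k))"

end

theory Submission
  imports Defs
begin

text \<open>
  In coordinates \<open>Rc\<^sub>\<mu>\<^sub>\<nu> = -1/2 g\<^sup>\<alpha>\<^sup>\<beta>\<partial>\<^sub>\<alpha>\<partial>\<^sub>\<beta> g\<^sub>\<mu>\<^sub>\<nu> + \<partial>\<^sub>(\<^sub>\<mu>\<Gamma>\<^sub>\<nu>\<^sub>)\<close> up to first-order terms, where
  \<open>\<Gamma>\<^sub>\<nu>\<close> is the contracted Christoffel symbol with lowered index; the gauge term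
  \<open>\<nabla>\<^sub>(\<^sub>\<mu>D\<^sub>\<nu>\<^sub>)\<close> replaces \<open>\<Gamma>\<^sub>\<nu>\<close> by an expression in the background connection and so removes
  its derivatives.  Likewise \<open>-dC\<close> cancels the mixed second derivatives in \<open>-d\<^sup>*dB\<close>, since
  partial derivatives commute.  Hence the equations, multiplied by \<open>-2\<close>, \<open>1\<close> and \<open>1\<close>, have
  principal part \<open>g\<^sup>\<mu>\<^sup>\<nu>\<partial>\<^sub>\<mu>\<partial>\<^sub>\<nu>\<close>.  The remainder is a polynomial in the inverse metric, an
  exponential of \<open>\<phi>\<close>, the first jet of the unknowns and the background variables, and each of its
  monomials contains a factor \<open>\<partial>g\<close>, \<open>B\<close>, \<open>\<partial>B\<close>, \<open>\<partial>\<phi>\<close> or a background variable.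
\<close>

section \<open>Closure properties of smooth functions\<close>

lemma continuous_fun_upd: "continuous_on UNIV (\<lambda>t. (v :: 'i \<Rightarrow> real)(i := t))"
proof (rule continuous_on_coordinatewise_then_product)
  fix j
  show "continuous_on UNIV (\<lambda>t. (v(i := t)) j)"
    by (cases "j = i") (auto intro: continuous_intros)
qed

text \<open>A point of an open set can be moved a little along any coordinate line. This is what
  makes derivatives in one variable insensitive to values outside \<open>W\<close>.\<close>

lemma eventually_fun_upd_mem:
  fixes W :: "('i \<Rightarrow> real) set"
  assumes "open W" "v \<in> W"
  shows "\<forall>\<^sub>F t in nhds (v i). v(i := t) \<in> W"
proof -
  have "open ((\<lambda>t. v(i := t)) -` W)"
    by (rule open_vimage[OF assms(1) continuous_fun_upd])
  moreover have "v i \<in> (\<lambda>t. v(i := t)) -` W"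
    using assms(2) by simp
  ultimately show ?thesis
    unfolding eventually_nhds by blast
qed

lemma Ck_continuous: "Ck k W F \<Longrightarrow> continuous_on W F"
  by (cases k) auto

text \<open>Openness of \<open>W\<close> turns agreement on \<open>W\<close> into agreement near
  \<open>v i\<close> on every coordinate line, so differentiability and \<open>deriv\<close> carry
  over and the induction passes to the derivatives.\<close>

lemma Ck_cong:
  assumes "open W" "\<And>v. v \<in> W \<Longrightarrow> F v = G v" "Ck k W F"
  shows "Ck k W G"
  using assms(2,3)
proof (induction k arbitrary: F G)
  case 0
  then show ?case by (auto cong: continuous_on_cong)
next
  case (Suc k)
  have ev: "\<forall>\<^sub>F t in nhds (v i). F (v(i := t)) = G (v(i := t))" if "v \<in> W" for v i
    using eventually_fun_upd_mem[OF assms(1) that] by eventually_elim (rule Suc.prems)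
  have "(\<lambda>t. G (v(i := t))) differentiable (at (v i))" if "v \<in> W" for v i
  proof -
    have "(\<lambda>t. F (v(i := t))) differentiable (at (v i))"
      using Suc.prems(2) that by simp
    then obtain D where "((\<lambda>t. F (v(i := t))) has_real_derivative D) (at (v i))"
      by (auto simp: real_differentiable_def)
    then have "((\<lambda>t. G (v(i := t))) has_real_derivative D) (at (v i))"
      using DERIV_cong_ev[OF refl ev[OF that] refl] by blast
    then show ?thesis
      by (auto simp: real_differentiable_def)
  qed
  moreover have "Ck k W (\<lambda>v. deriv (\<lambda>t. G (v(i := t))) (v i))" for i
    using Suc.IH[of "\<lambda>v. deriv (\<lambda>t. F (v(i := t))) (v i)"] Suc.prems(2) deriv_cong_ev[OF ev refl]
    by simp
  moreover have "continuous_on W G"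
    using Suc.prems by (auto cong: continuous_on_cong)
  ultimately show ?case by simp
qed

text \<open>Derivatives may be supplied as explicit formulas instead of through
  \<open>deriv\<close>; uniqueness of derivatives and \<open>Ck_cong\<close> identify the two on
  \<open>W\<close>. All closure proofs below go through this rule and its converse
  \<open>Ck_SucE\<close>.\<close>

lemma Ck_SucI:
  assumes "open W" "continuous_on W F"
    and "\<And>i. \<exists>F'. Ck k W F' \<and> (\<forall>v\<in>W. ((\<lambda>t. F (v(i := t))) has_real_derivative F' v) (at (v i)))"
  shows "Ck (Suc k) W F"
proof -
  have "(\<forall>v\<in>W. (\<lambda>t. F (v(i := t))) differentiable (at (v i))) \<and>
        Ck k W (\<lambda>v. deriv (\<lambda>t. F (v(i := t))) (v i))" for i
  proof -
    obtain F' where F': "Ck k W F'"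
        "\<And>v. v \<in> W \<Longrightarrow> ((\<lambda>t. F (v(i := t))) has_real_derivative F' v) (at (v i))"
      using assms(3)[of i] by blast
    have "Ck k W (\<lambda>v. deriv (\<lambda>t. F (v(i := t))) (v i))"
      by (rule Ck_cong[OF assms(1) _ F'(1)]) (use DERIV_imp_deriv[OF F'(2)] in simp)
    with F'(2) show ?thesis
      by (auto simp: real_differentiable_def)
  qed
  with assms(2) show ?thesis by simp
qed

lemma Ck_SucE:
  assumes "Ck (Suc k) W F"
  obtains F' where "\<And>i. Ck k W (F' i)"
    "\<And>i v. v \<in> W \<Longrightarrow> ((\<lambda>t. F (v(i := t))) has_real_derivative F' i v) (at (v i))"
proof
  show "Ck k W (\<lambda>v. deriv (\<lambda>t. F (v(i := t))) (v i))" for i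
    using assms by simp
  show "((\<lambda>t. F (v(i := t))) has_real_derivative deriv (\<lambda>t. F (v(i := t))) (v i)) (at (v i))"
    if "v \<in> W" for i v
    using assms that by (simp add: DERIV_deriv_iff_real_differentiable)
qed

lemma Ck_SucD: "Ck (Suc k) W F \<Longrightarrow> Ck k W F"
proof (induction k arbitrary: F)
  case (Suc k)
  then show ?case by (simp del: fun_upd_apply)
qed simp

lemma Ck_subset: "Ck k W F \<Longrightarrow> W' \<subseteq> W \<Longrightarrow> Ck k W' F"
  by (induction k arbitrary: F) (auto intro: continuous_on_subset)

section \<open>Arithmetic, reciprocals and exponentials of \<open>Ck\<close> functions\<close>

lemma Ck_const: "open W \<Longrightarrow> Ck k W (\<lambda>_. c)"
proof (induction k arbitrary: c)
  case (Suc k)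
  then show ?case
    by (intro Ck_SucI) (auto intro!: exI[of _ "\<lambda>_. 0"] derivative_eq_intros)
qed simp

lemma Ck_coord: "open W \<Longrightarrow> Ck k W (\<lambda>v. v j)"
proof (cases k)
  case (Suc m)
  assume "open W"
  have "Ck (Suc m) W (\<lambda>v. v j)"
  proof (rule Ck_SucI[OF \<open>open W\<close>])
    fix i
    show "\<exists>F'. Ck m W F' \<and> (\<forall>v\<in>W. ((\<lambda>t. (v(i := t)) j) has_real_derivative F' v) (at (v i)))"
      by (rule exI[of _ "\<lambda>_. if j = i then 1 else 0"])
        (auto intro!: Ck_const derivative_eq_intros \<open>open W\<close>)
  qed (auto intro: continuous_on_product_then_coordinatewise continuous_intros)
  with Suc show ?thesis by simp
qed (auto intro: continuous_on_product_then_coordinatewise continuous_intros)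

lemma Ck_add: "open W \<Longrightarrow> Ck k W F \<Longrightarrow> Ck k W G \<Longrightarrow> Ck k W (\<lambda>v. F v + G v)"
proof (induction k arbitrary: F G)
  case (Suc k)
  obtain F' G' where "\<And>i. Ck k W (F' i)" "\<And>i. Ck k W (G' i)"
    "\<And>i v. v \<in> W \<Longrightarrow> ((\<lambda>t. F (v(i := t))) has_real_derivative F' i v) (at (v i))"
    "\<And>i v. v \<in> W \<Longrightarrow> ((\<lambda>t. G (v(i := t))) has_real_derivative G' i v) (at (v i))"
    using Suc.prems(2,3) by (elim Ck_SucE) blast
  note * = this
  show ?case
  proof (rule Ck_SucI[OF \<open>open W\<close>])
    show "continuous_on W (\<lambda>v. F v + G v)"
      using Suc.prems by (auto intro: continuous_on_add dest: Ck_continuous simp del: Ck.simps)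
    fix i
    have "((\<lambda>t. F (v(i := t)) + G (v(i := t))) has_real_derivative F' i v + G' i v) (at (v i))"
      if "v \<in> W" for v
      using DERIV_add[OF *(3,4)[OF that, of i]] .
    then show "\<exists>H. Ck k W H \<and>
        (\<forall>v\<in>W. ((\<lambda>t. F (v(i := t)) + G (v(i := t))) has_real_derivative H v) (at (v i)))"
      using Suc.IH[OF \<open>open W\<close> *(1)[of i] *(2)[of i]] by blast
  qed
qed (auto intro: continuous_intros)

text \<open>By the product rule the derivative is a sum of products of functions of class
  \<open>Ck k\<close>. The induction generalises over both factors because it is applied to a
  derivative paired with an original function.\<close>

lemma Ck_mult: "open W \<Longrightarrow> Ck k W F \<Longrightarrow> Ck k W G \<Longrightarrow> Ck k W (\<lambda>v. F v * G v)"
proof (induction k arbitrary: F G)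
  case (Suc k)
  obtain F' G' where *: "\<And>i. Ck k W (F' i)" "\<And>i. Ck k W (G' i)"
    "\<And>i v. v \<in> W \<Longrightarrow> ((\<lambda>t. F (v(i := t))) has_real_derivative F' i v) (at (v i))"
    "\<And>i v. v \<in> W \<Longrightarrow> ((\<lambda>t. G (v(i := t))) has_real_derivative G' i v) (at (v i))"
    using Suc.prems(2,3) by (elim Ck_SucE) blast
  show ?case
  proof (rule Ck_SucI[OF \<open>open W\<close>])
    show "continuous_on W (\<lambda>v. F v * G v)"
      using Suc.prems by (auto intro: continuous_on_mult dest: Ck_continuous simp del: Ck.simps)
    fix i
    have "((\<lambda>t. F (v(i := t)) * G (v(i := t))) has_real_derivative F' i v * G v + G' i v * F v) (at (v i))"
      if "v \<in> W" for v
      using DERIV_mult[OF *(3,4)[OF that, of i]] by simp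
    moreover have "Ck k W (\<lambda>v. F' i v * G v + G' i v * F v)"
      using Suc.prems * by (auto intro!: Ck_add Suc.IH dest: Ck_SucD simp del: Ck.simps)
    ultimately show "\<exists>H. Ck k W H \<and>
        (\<forall>v\<in>W. ((\<lambda>t. F (v(i := t)) * G (v(i := t))) has_real_derivative H v) (at (v i)))"
      by blast
  qed
qed (auto intro: continuous_intros)

text \<open>The derivative is again built from \<open>inverse (F v)\<close> and the derivative of
  \<open>F\<close>, so the induction hypothesis is needed only for the same \<open>F\<close>, now
  with one order of smoothness less.\<close>

lemma Ck_inverse: "open W \<Longrightarrow> Ck k W F \<Longrightarrow> (\<And>v. v \<in> W \<Longrightarrow> F v \<noteq> 0) \<Longrightarrow> Ck k W (\<lambda>v. inverse (F v))"
proof (induction k)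
  case (Suc k)
  obtain F' where *: "\<And>i. Ck k W (F' i)"
    "\<And>i v. v \<in> W \<Longrightarrow> ((\<lambda>t. F (v(i := t))) has_real_derivative F' i v) (at (v i))"
    using Suc.prems(2) by (elim Ck_SucE) blast
  have inv: "Ck k W (\<lambda>v. inverse (F v))"
    using Suc.prems by (intro Suc.IH) (auto dest: Ck_SucD simp del: Ck.simps)
  show ?case
  proof (rule Ck_SucI[OF \<open>open W\<close>])
    show "continuous_on W (\<lambda>v. inverse (F v))"
      using Suc.prems by (auto intro!: continuous_on_inverse dest: Ck_continuous simp del: Ck.simps)
    fix i
    have "((\<lambda>t. inverse (F (v(i := t)))) has_real_derivative
        -1 * (inverse (F v) * F' i v * inverse (F v))) (at (v i))" if "v \<in> W" for v
      using DERIV_inverse'[OF *(2)[OF that, of i]] Suc.prems(3)[OF that] by simp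
    moreover have "Ck k W (\<lambda>v. -1 * (inverse (F v) * F' i v * inverse (F v)))"
      by (intro Ck_mult inv * Ck_const \<open>open W\<close>)
    ultimately show "\<exists>H. Ck k W H \<and>
        (\<forall>v\<in>W. ((\<lambda>t. inverse (F (v(i := t)))) has_real_derivative H v) (at (v i)))"
      by blast
  qed
qed (auto intro: continuous_intros)

lemma Ck_exp: "open W \<Longrightarrow> Ck k W F \<Longrightarrow> Ck k W (\<lambda>v. exp (F v))"
proof (induction k)
  case (Suc k)
  obtain F' where *: "\<And>i. Ck k W (F' i)"
    "\<And>i v. v \<in> W \<Longrightarrow> ((\<lambda>t. F (v(i := t))) has_real_derivative F' i v) (at (v i))"
    using Suc.prems(2) by (elim Ck_SucE) blast
  have e: "Ck k W (\<lambda>v. exp (F v))"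
    using Suc.prems by (intro Suc.IH) (auto dest: Ck_SucD simp del: Ck.simps)
  show ?case
  proof (rule Ck_SucI[OF \<open>open W\<close>])
    show "continuous_on W (\<lambda>v. exp (F v))"
      using Suc.prems by (auto intro!: continuous_on_exp dest: Ck_continuous simp del: Ck.simps)
    fix i
    have "((\<lambda>t. exp (F (v(i := t)))) has_real_derivative exp (F v) * F' i v) (at (v i))"
      if "v \<in> W" for v
      using DERIV_fun_exp[OF *(2)[OF that, of i]] by simp
    moreover have "Ck k W (\<lambda>v. exp (F v) * F' i v)"
      by (intro Ck_mult e * \<open>open W\<close>)
    ultimately show "\<exists>H. Ck k W H \<and>
        (\<forall>v\<in>W. ((\<lambda>t. exp (F (v(i := t)))) has_real_derivative H v) (at (v i)))"
      by blast
  qed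
qed (auto intro: continuous_intros)

section \<open>Smooth functions of a renamed subfamily of the variables\<close>

lemma continuous_on_comp_vars: "continuous_on UNIV (\<lambda>v :: 'j \<Rightarrow> real. v \<circ> (r :: 'i \<Rightarrow> 'j))"
  by (rule continuous_on_coordinatewise_then_product)
    (auto intro: continuous_on_product_then_coordinatewise continuous_intros)

lemma open_comp_vars:
  fixes r :: "'i \<Rightarrow> 'j" and W :: "('i \<Rightarrow> real) set"
  assumes "open W"
  shows "open {v :: 'j \<Rightarrow> real. v \<circ> r \<in> W}"
  using open_vimage[OF assms continuous_on_comp_vars[of r]] by (simp add: vimage_def)

text \<open>Since \<open>r\<close> is injective, changing the variable \<open>r i\<close> changes
  exactly the \<open>i\<close>-th argument of \<open>G\<close>, and its derivative is that of
  \<open>G\<close> at the renamed point. A variable outside the range of \<open>r\<close> does not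
  enter at all and gives derivative zero.\<close>

lemma Ck_comp_vars:
  fixes r :: "'i \<Rightarrow> 'j"
  assumes "open W" "inj r" "Ck k W G"
  shows "Ck k {v. v \<circ> r \<in> W} (\<lambda>v. G (v \<circ> r))"
  using assms(3)
proof (induction k arbitrary: G)
  case 0
  then show ?case
    using continuous_on_compose2[of W G "{v. v \<circ> r \<in> W}" "\<lambda>v. v \<circ> r"]
      continuous_on_subset[OF continuous_on_comp_vars] by (auto simp del: comp_apply simp: comp_def)
next
  case (Suc k)
  let ?W = "{v. v \<circ> r \<in> W}"
  obtain G' where G': "\<And>i. Ck k W (G' i)"
    "\<And>i v. v \<in> W \<Longrightarrow> ((\<lambda>t. G (v(i := t))) has_real_derivative G' i v) (at (v i))"
    using Suc.prems by (elim Ck_SucE) blast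
  have op: "open ?W" by (rule open_comp_vars[OF assms(1)])
  show ?case
  proof (rule Ck_SucI[OF op])
    have "continuous_on W G" using Suc.prems by simp
    then show "continuous_on ?W (\<lambda>v. G (v \<circ> r))"
      using continuous_on_compose2[of W G ?W "\<lambda>v. v \<circ> r"]
        continuous_on_subset[OF continuous_on_comp_vars] by (auto simp: comp_def)
    fix j
    show "\<exists>F'. Ck k ?W F' \<and>
      (\<forall>v\<in>?W. ((\<lambda>t. G (v(j := t) \<circ> r)) has_real_derivative F' v) (at (v j)))"
    proof (cases "j \<in> range r")
      case True
      then obtain i where i: "j = r i" by blast
      have "v(r i := t) \<circ> r = (v \<circ> r)(i := t)" for v :: "'j \<Rightarrow> real" and t
        using assms(2) by (auto simp: fun_eq_iff inj_eq)
      then show ?thesis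
        using Suc.IH[OF G'(1)[of i]] G'(2)[of "_ \<circ> r" i] i
        by (intro exI[of _ "\<lambda>v. G' i (v \<circ> r)"]) (simp del: fun_upd_apply Ck.simps add: comp_def)
    next
      case False
      then have "v(j := t) \<circ> r = v \<circ> r" for v :: "'j \<Rightarrow> real" and t
        by (auto simp: fun_eq_iff)
      then show ?thesis
        using Ck_const[OF op, of k 0] by (intro exI[of _ "\<lambda>_. 0"]) auto
    qed
  qed
qed

text \<open>Openness is bundled with smoothness, which frees most closure rules from a side
  condition and lets them be chained.\<close>

definition C_inf :: "('i \<Rightarrow> real) set \<Rightarrow> (('i \<Rightarrow> real) \<Rightarrow> real) \<Rightarrow> bool" where
  "C_inf W F \<longleftrightarrow> open W \<and> (\<forall>k. Ck k W F)"

lemma C_inf_const: "open W \<Longrightarrow> C_inf W (\<lambda>_. c)"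
  by (simp add: C_inf_def Ck_const del: Ck.simps)

lemma C_inf_coord: "open W \<Longrightarrow> C_inf W (\<lambda>v. v j)"
  by (simp add: C_inf_def Ck_coord del: Ck.simps)

lemma C_inf_add: "C_inf W F \<Longrightarrow> C_inf W G \<Longrightarrow> C_inf W (\<lambda>v. F v + G v)"
  by (simp add: C_inf_def Ck_add del: Ck.simps)

lemma C_inf_mult: "C_inf W F \<Longrightarrow> C_inf W G \<Longrightarrow> C_inf W (\<lambda>v. F v * G v)"
  by (simp add: C_inf_def Ck_mult del: Ck.simps)

lemma C_inf_exp: "C_inf W F \<Longrightarrow> C_inf W (\<lambda>v. exp (F v))"
  by (simp add: C_inf_def Ck_exp del: Ck.simps)

lemma C_inf_inverse: "C_inf W F \<Longrightarrow> (\<And>v. v \<in> W \<Longrightarrow> F v \<noteq> 0) \<Longrightarrow> C_inf W (\<lambda>v. inverse (F v))"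
  by (simp add: C_inf_def Ck_inverse del: Ck.simps)

lemma C_inf_comp_vars: "C_inf W F \<Longrightarrow> inj r \<Longrightarrow> C_inf {v. v \<circ> r \<in> W} (\<lambda>v. F (v \<circ> r))"
  by (simp add: C_inf_def Ck_comp_vars open_comp_vars del: Ck.simps)

lemma C_inf_subset: "C_inf W F \<Longrightarrow> open W' \<Longrightarrow> W' \<subseteq> W \<Longrightarrow> C_inf W' F"
  by (meson C_inf_def Ck_subset)

lemma C_inf_cong: "C_inf W F \<Longrightarrow> (\<And>v. v \<in> W \<Longrightarrow> F v = G v) \<Longrightarrow> C_inf W G"
  unfolding C_inf_def using Ck_cong[of W F G] by blast

lemma C_inf_uminus: "C_inf W F \<Longrightarrow> C_inf W (\<lambda>v. - F v)"
  using C_inf_mult[OF C_inf_const[of W "-1"]] by (simp add: C_inf_def)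

lemma C_inf_diff: "C_inf W F \<Longrightarrow> C_inf W G \<Longrightarrow> C_inf W (\<lambda>v. F v - G v)"
  using C_inf_add[OF _ C_inf_uminus] by fastforce

lemma C_inf_divide:
  "C_inf W F \<Longrightarrow> C_inf W G \<Longrightarrow> (\<And>v. v \<in> W \<Longrightarrow> G v \<noteq> 0) \<Longrightarrow> C_inf W (\<lambda>v. F v / G v)"
  by (simp add: divide_inverse C_inf_mult C_inf_inverse)

lemma C_inf_sum: "open W \<Longrightarrow> (\<And>i. i \<in> I \<Longrightarrow> C_inf W (F i)) \<Longrightarrow> C_inf W (\<lambda>v. \<Sum>i\<in>I. F i v)"
  by (induction I rule: infinite_finite_induct) (auto intro: C_inf_const C_inf_add)

lemma C_inf_prod: "open W \<Longrightarrow> (\<And>i. i \<in> I \<Longrightarrow> C_inf W (F i)) \<Longrightarrow> C_inf W (\<lambda>v. \<Prod>i\<in>I. F i v)"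
  by (induction I rule: infinite_finite_induct) (auto intro: C_inf_const C_inf_mult)

section \<open>Smooth dependence of determinants and inverse matrices on their entries\<close>

lemma C_inf_det:
  assumes "open W" "\<And>i j. C_inf W (\<lambda>v. A v $ i $ j)"
  shows "C_inf W (\<lambda>v. det (A v :: real^'n^'n))"
  unfolding det_def by (intro C_inf_sum C_inf_mult C_inf_prod C_inf_const assms)

lemma matrix_inv_right: "invertible A \<Longrightarrow> A ** matrix_inv A = mat 1"
  and matrix_inv_left: "invertible A \<Longrightarrow> matrix_inv A ** A = mat 1"
  unfolding invertible_def matrix_inv_def by (metis (mono_tags, lifting) someI_ex)+

text \<open>Column \<open>\<nu>\<close> of the inverse solves the linear system with right-hand side
  the \<open>\<nu>\<close>-th unit vector, to which Cramer's rule applies. As a quotient of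
  determinants the inverse is visibly smooth.\<close>

lemma matrix_inv_cramer:
  fixes A :: "real^'n^'n"
  assumes "det A \<noteq> 0"
  shows "matrix_inv A $ \<mu> $ \<nu> =
    det (\<chi> i j. if j = \<mu> then (if i = \<nu> then 1 else 0) else A $ i $ j) / det A"
proof -
  have "A *v (matrix_inv A *v axis \<nu> 1) = axis \<nu> 1"
    using assms by (simp add: matrix_vector_mul_assoc matrix_inv_right invertible_det_nz)
  then have "matrix_inv A *v axis \<nu> 1 = (\<chi> k. det (\<chi> i j. if j = k then axis \<nu> 1 $ i else A $ i $ j) / det A)"
    using cramer[OF assms] by blast
  moreover have "(matrix_inv A *v axis \<nu> 1) $ \<mu> = matrix_inv A $ \<mu> $ \<nu>"
    by (simp add: matrix_vector_mult_basis column_def)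
  ultimately show ?thesis by (simp add: axis_def cong: if_cong)
qed

lemma C_inf_matrix_inv:
  assumes "\<And>i j. C_inf W (\<lambda>v. A v $ i $ j)" "\<And>v. v \<in> W \<Longrightarrow> det (A v :: real^'n^'n) \<noteq> 0"
  shows "C_inf W (\<lambda>v. matrix_inv (A v) $ \<mu> $ \<nu>)"
proof -
  have W: "open W" using assms(1) by (simp add: C_inf_def)
  have "C_inf W (\<lambda>v. det (\<chi> i j. if j = \<mu> then (if i = \<nu> then 1 else 0) else A v $ i $ j) / det (A v))"
    proof (intro C_inf_divide C_inf_det assms W)
    show "C_inf W (\<lambda>v. (\<chi> i j. if j = \<mu> then (if i = \<nu> then 1 else 0) else A v $ i $ j) $ i $ j)" for i j
      by (cases "j = \<mu>") (auto intro: assms(1) C_inf_const W)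
  qed
  then show ?thesis
    by (rule C_inf_cong) (simp add: matrix_inv_cramer assms(2))
qed

text \<open>Applied to the determinant of the metric variables: it yields open neighbourhoods of the
  sets of Lorentzian matrices, which are confined to symmetric matrices and so need not be
  open.\<close>

lemma open_C_inf_nonzero:
  assumes "C_inf W F" shows "open {v \<in> W. F v \<noteq> 0}"
proof -
  have "continuous_on W F" "open W" using assms Ck_continuous by (auto simp: C_inf_def)
  then have "open (W \<inter> F -` (- {0}))" by (intro continuous_open_preimage) auto
  moreover have "W \<inter> F -` (- {0}) = {v \<in> W. F v \<noteq> 0}" by auto
  ultimately show ?thesis by simp
qed

section \<open>Partial derivatives of smooth functions\<close>

lemma continuous_on_vec_of_vars: "continuous_on UNIV (\<lambda>v :: 'n::finite \<Rightarrow> real. \<chi> i. v i)"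
  by (intro continuous_on_vec_lambda continuous_on_product_coordinates)

lemma open_vec_preimage: "open U \<Longrightarrow> open {v :: 'n::finite \<Rightarrow> real. (\<chi> i. v i) \<in> U}"
  using open_vimage[OF _ continuous_on_vec_of_vars] by (simp add: vimage_def)

text \<open>For open \<open>U\<close> the smooth extension demanded by \<open>smooth_vars_on\<close>
  can be restricted to \<open>U\<close> itself, where it equals \<open>h\<close>. This transports
  the \<open>C_inf\<close> rules to functions of vectors.\<close>

lemma smooth_on_iff_C_inf:
  assumes "open U"
  shows "smooth_on U h \<longleftrightarrow> C_inf {v. (\<chi> i. v i) \<in> U} (\<lambda>v. h (\<chi> i. v i))"
proof -
  let ?A = "{v. (\<chi> i. v i) \<in> U}"
  have op: "open ?A"
    by (rule open_vec_preimage[OF assms])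
  show ?thesis
  proof
    assume "smooth_on U h"
    then obtain W G where "open W" "?A \<subseteq> W" "\<forall>k. Ck k W G" "\<forall>v\<in>?A. h (\<chi> i. v i) = G v"
      by (auto simp: smooth_on_def smooth_vars_on_def)
    then have "C_inf ?A G"
      using C_inf_subset[OF _ op] by (auto simp: C_inf_def)
    then show "C_inf ?A (\<lambda>v. h (\<chi> i. v i))"
      by (rule C_inf_cong) (use \<open>\<forall>v\<in>?A. _\<close> in simp)
  next
    assume "C_inf ?A (\<lambda>v. h (\<chi> i. v i))"
    then show "smooth_on U h"
      unfolding smooth_on_def smooth_vars_on_def C_inf_def by blast
  qed
qed

lemma vec_fun_upd: "(\<chi> j. (v(i := t)) j) = (\<chi> j. v j) + (t - v i) *\<^sub>R axis i (1::real)"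
  by (simp add: vec_eq_iff axis_def)

text \<open>\<open>Ck\<close> varies the value of a coordinate, \<open>pd\<close> an increment added
  to the point; the two parameters differ by the shift \<open>v i\<close>.\<close>

lemma has_derivative_vec_fun_upd_iff:
  "((\<lambda>t. h (\<chi> j. (v(i := t)) j)) has_real_derivative D) (at (v i)) \<longleftrightarrow>
   ((\<lambda>t. h ((\<chi> j. v j) + t *\<^sub>R axis i 1)) has_real_derivative D) (at 0)"
  using DERIV_shift[of "\<lambda>t. h (\<chi> j. (v(i := t)) j)" D 0 "v i"]
  by (simp add: vec_fun_upd del: fun_upd_apply)

lemma pd_vec: "pd i h (\<chi> j. v j) = deriv (\<lambda>t. h (\<chi> j. (v(i := t)) j)) (v i)"
  unfolding pd_def deriv_def has_derivative_vec_fun_upd_iff ..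

lemma smooth_on_has_pd:
  assumes "open U" "smooth_on U h" "x \<in> U"
  shows "((\<lambda>t. h (x + t *\<^sub>R axis i 1)) has_real_derivative pd i h x) (at 0)"
proof -
  have "Ck (Suc 0) {v. (\<chi> i. v i) \<in> U} (\<lambda>v. h (\<chi> i. v i))"
    using assms(1,2) smooth_on_iff_C_inf C_inf_def by blast
  \<comment> \<open>\<open>($) x\<close> is the point of variable space that represents the vector
    \<open>x\<close>.\<close>
  then have "(\<lambda>t. h (\<chi> j. ((($) x)(i := t)) j)) differentiable (at (x $ i))"
    using assms(3) by (auto simp del: fun_upd_apply)
  then have "((\<lambda>t. h (\<chi> j. ((($) x)(i := t)) j)) has_real_derivative
      deriv (\<lambda>t. h (\<chi> j. ((($) x)(i := t)) j)) (x $ i)) (at (x $ i))"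
    using DERIV_deriv_iff_real_differentiable by blast
  then show ?thesis
    using has_derivative_vec_fun_upd_iff[of h "($) x" i] pd_vec[of i h "($) x"]
    by (simp del: fun_upd_apply)
qed

lemma smooth_on_pd:
  assumes "open U" "smooth_on U h" shows "smooth_on U (pd i h)"
proof -
  have "Ck (Suc k) {v. (\<chi> i. v i) \<in> U} (\<lambda>v. h (\<chi> i. v i))" for k
    using assms by (simp add: smooth_on_iff_C_inf C_inf_def del: Ck.simps)
  then show ?thesis
    using assms by (simp add: smooth_on_iff_C_inf C_inf_def pd_vec del: fun_upd_apply)
qed

lemma smooth_on_pds: "open U \<Longrightarrow> smooth_on U h \<Longrightarrow> smooth_on U (pds \<alpha> h)"
  by (induction \<alpha>) (auto intro: smooth_on_pd)

lemma smooth_on_continuous: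
  assumes "open U" "smooth_on U h" shows "continuous_on U h"
proof -
  let ?A = "{v. (\<chi> i. v i) \<in> U}"
  have "continuous_on ?A (\<lambda>v. h (\<chi> i. v i))"
    using assms by (auto simp: smooth_on_iff_C_inf C_inf_def intro: Ck_continuous)
  moreover have "continuous_on U (\<lambda>x. ($) x)"
    by (intro continuous_on_coordinatewise_then_product continuous_intros)
  ultimately have "continuous_on U (\<lambda>x. h (\<chi> i. x $ i))"
    by (rule continuous_on_compose2) auto
  then show ?thesis by simp
qed

section \<open>Locality and symmetry of partial derivatives\<close>

lemma pd_cong:
  assumes "open U" "x \<in> U" "\<And>y. y \<in> U \<Longrightarrow> h y = h' y"
  shows "pd i h x = pd i h' x"
proof -
  have "open ((\<lambda>t. x + t *\<^sub>R axis i 1) -` U)"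
    by (rule open_vimage[OF assms(1)]) (intro continuous_intros)
  moreover have "0 \<in> (\<lambda>t. x + t *\<^sub>R axis i 1) -` U" using assms(2) by simp
  ultimately have "\<forall>\<^sub>F t in nhds 0. t \<in> (\<lambda>t. x + t *\<^sub>R axis i 1) -` U"
    by (rule eventually_nhds_in_open)
  then show ?thesis
    unfolding pd_def by (intro deriv_cong_ev) (auto elim!: eventually_mono intro: assms(3))
qed

lemma pd_eqI: "((\<lambda>t. h (x + t *\<^sub>R axis i 1)) has_real_derivative D) (at 0) \<Longrightarrow> pd i h x = D"
  unfolding pd_def by (rule DERIV_imp_deriv)

text \<open>The mean value theorem is used twice: in direction \<open>i\<close> for the difference
  of \<open>h\<close> across the square, then in direction \<open>j\<close> for
  \<open>pd i h\<close>.\<close>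

lemma second_difference_mean_value:
  assumes "open U" "smooth_on U h" "s > 0"
    and sub: "\<And>a b. 0 \<le> a \<Longrightarrow> a \<le> s \<Longrightarrow> 0 \<le> b \<Longrightarrow> b \<le> s \<Longrightarrow> x + a *\<^sub>R axis i 1 + b *\<^sub>R axis j 1 \<in> U"
  obtains a b where "0 \<le> a" "a \<le> s" "0 \<le> b" "b \<le> s"
    "h (x + s *\<^sub>R axis i 1 + s *\<^sub>R axis j 1) - h (x + s *\<^sub>R axis i 1)
      - h (x + s *\<^sub>R axis j 1) + h x = s * (s * pd j (pd i h) (x + a *\<^sub>R axis i 1 + b *\<^sub>R axis j 1))"
proof -
  have der: "((\<lambda>t. f (y + t *\<^sub>R axis k 1)) has_real_derivative pd k f (y + t *\<^sub>R axis k 1)) (at t)"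
    if "smooth_on U f" "y + t *\<^sub>R axis k 1 \<in> U" for f y k t
    using smooth_on_has_pd[OF assms(1) that, of k] DERIV_shift[of "\<lambda>t. f (y + t *\<^sub>R axis k 1)" _ 0 t]
    by (simp add: algebra_simps)
  let ?d = "\<lambda>a. h (x + s *\<^sub>R axis j 1 + a *\<^sub>R axis i 1) - h (x + a *\<^sub>R axis i 1)"
  have "\<exists>a>0. a < s \<and> ?d s - ?d 0 =
      (s - 0) * (pd i h (x + s *\<^sub>R axis j 1 + a *\<^sub>R axis i 1) - pd i h (x + a *\<^sub>R axis i 1))"
  proof (rule MVT2[OF \<open>s > 0\<close>])
    fix a assume "0 \<le> a" "a \<le> s"
    then show "(?d has_real_derivative
        pd i h (x + s *\<^sub>R axis j 1 + a *\<^sub>R axis i 1) - pd i h (x + a *\<^sub>R axis i 1)) (at a)"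
      using sub[of a s] sub[of a 0] \<open>s > 0\<close> by (intro DERIV_diff der assms) (auto simp: add_ac)
  qed
  then obtain a where a: "0 < a" "a < s" "?d s - ?d 0 =
      s * (pd i h (x + s *\<^sub>R axis j 1 + a *\<^sub>R axis i 1) - pd i h (x + a *\<^sub>R axis i 1))"
    by auto
  let ?e = "\<lambda>b. pd i h (x + a *\<^sub>R axis i 1 + b *\<^sub>R axis j 1)"
  have "\<exists>b>0. b < s \<and> ?e s - ?e 0 = (s - 0) * pd j (pd i h) (x + a *\<^sub>R axis i 1 + b *\<^sub>R axis j 1)"
    by (rule MVT2[OF \<open>s > 0\<close>]) (use sub a in \<open>auto intro!: der smooth_on_pd assms\<close>)
  then obtain b where "0 < b" "b < s"
    "?e s - ?e 0 = s * pd j (pd i h) (x + a *\<^sub>R axis i 1 + b *\<^sub>R axis j 1)"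
    by auto
  with a that[of a b] show thesis by (simp add: add_ac)
qed

text \<open>The second difference over a small square is symmetric in the two directions. Evaluated
  in both orders it equals \<open>s * s\<close> times each mixed derivative at some point of the
  square, so continuity at \<open>x\<close> excludes distinct values.\<close>

lemma pd_commute:
  assumes "open U" "smooth_on U h" "x \<in> U"
  shows "pd i (pd j h) x = pd j (pd i h) x"
proof (rule ccontr)
  assume neq: "pd i (pd j h) x \<noteq> pd j (pd i h) x"
  \<comment> \<open>Half of the supposed gap, so that two errors below \<open>\<epsilon>\<close>
    cannot add up to the gap.\<close>
  define \<epsilon> where "\<epsilon> = \<bar>pd i (pd j h) x - pd j (pd i h) x\<bar> / 2"
  have "\<epsilon> > 0" using neq by (simp add: \<epsilon>_def)
  have cont: "continuous_on U (pd k (pd l h))" for k l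
    by (intro smooth_on_continuous smooth_on_pd assms)
  have "\<exists>d>0. \<forall>y\<in>U. dist y x < d \<longrightarrow> dist (pd k (pd l h) y) (pd k (pd l h) x) < \<epsilon>" for k l
    using cont[of k l] assms(3) \<open>\<epsilon> > 0\<close> unfolding continuous_on_iff by blast
  then obtain d where d: "\<And>k l. d k l > 0"
    "\<And>k l y. y \<in> U \<Longrightarrow> dist y x < d k l \<Longrightarrow> \<bar>pd k (pd l h) y - pd k (pd l h) x\<bar> < \<epsilon>"
    unfolding dist_real_def by metis
  obtain r where r: "r > 0" "ball x r \<subseteq> U"
    using assms(1,3) open_contains_ball by blast
  \<comment> \<open>Points of the square lie within \<open>2 * s\<close> of \<open>x\<close>, so
    \<open>3 * s\<close> is a strict bound that stays below the radius \<open>r\<close> and both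
    continuity moduli.\<close>
  define s where "s = min r (min (d i j) (d j i)) / 3"
  have "s > 0" and s: "3 * s \<le> r" "3 * s \<le> d i j" "3 * s \<le> d j i"
    using r d by (auto simp: s_def)
  have near: "dist (x + a *\<^sub>R axis k 1 + b *\<^sub>R axis l 1) x < 3 * s"
    if "0 \<le> a" "a \<le> s" "0 \<le> b" "b \<le> s" for a b k l
  proof -
    have "norm (a *\<^sub>R axis k (1::real) + b *\<^sub>R axis l 1) \<le> a + b"
      by (rule order_trans[OF norm_triangle_ineq]) (use that in simp)
    then show ?thesis using that \<open>s > 0\<close> by (simp add: dist_norm add.assoc)
  qed
  have inU: "x + a *\<^sub>R axis k 1 + b *\<^sub>R axis l 1 \<in> U"
    if "0 \<le> a" "a \<le> s" "0 \<le> b" "b \<le> s" for a b k l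
    using near[OF that, of k l] s r(2) by (auto simp: dist_commute subset_iff)
  let ?\<Delta> = "h (x + s *\<^sub>R axis i 1 + s *\<^sub>R axis j 1) - h (x + s *\<^sub>R axis i 1)
      - h (x + s *\<^sub>R axis j 1) + h x"
  obtain a b where ab: "0 \<le> a" "a \<le> s" "0 \<le> b" "b \<le> s"
    "?\<Delta> = s * (s * pd j (pd i h) (x + a *\<^sub>R axis i 1 + b *\<^sub>R axis j 1))"
    by (rule second_difference_mean_value[OF assms(1,2) \<open>s > 0\<close> inU])
  obtain a' b' where ab': "0 \<le> a'" "a' \<le> s" "0 \<le> b'" "b' \<le> s"
    "h (x + s *\<^sub>R axis j 1 + s *\<^sub>R axis i 1) - h (x + s *\<^sub>R axis j 1) - h (x + s *\<^sub>R axis i 1) + h x =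
      s * (s * pd i (pd j h) (x + a' *\<^sub>R axis j 1 + b' *\<^sub>R axis i 1))"
    by (rule second_difference_mean_value[OF assms(1,2) \<open>s > 0\<close> inU])
  then have ab'_eq: "?\<Delta> = s * (s * pd i (pd j h) (x + a' *\<^sub>R axis j 1 + b' *\<^sub>R axis i 1))"
    by (simp add: add_ac)
  have "pd j (pd i h) (x + a *\<^sub>R axis i 1 + b *\<^sub>R axis j 1) =
      pd i (pd j h) (x + a' *\<^sub>R axis j 1 + b' *\<^sub>R axis i 1)"
    using ab(5) ab'_eq \<open>s > 0\<close> by simp
  moreover have "\<bar>pd j (pd i h) (x + a *\<^sub>R axis i 1 + b *\<^sub>R axis j 1) - pd j (pd i h) x\<bar> < \<epsilon>"
    by (rule d(2)) (use inU near[of a b i j] ab s in auto)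
  moreover have "\<bar>pd i (pd j h) (x + a' *\<^sub>R axis j 1 + b' *\<^sub>R axis i 1) - pd i (pd j h) x\<bar> < \<epsilon>"
    by (rule d(2)) (use inU near[of a' b' j i] ab' s in auto)
  ultimately have "\<bar>pd i (pd j h) x - pd j (pd i h) x\<bar> < \<epsilon> + \<epsilon>"
    by linarith
  then show False by (simp add: \<epsilon>_def)
qed

section \<open>Arithmetic of smooth functions on a coordinate domain\<close>

lemma smooth_on_const: "open U \<Longrightarrow> smooth_on U (\<lambda>_. c)"
  by (simp add: smooth_on_iff_C_inf C_inf_const open_vec_preimage)

lemma smooth_on_add: "open U \<Longrightarrow> smooth_on U h \<Longrightarrow> smooth_on U k \<Longrightarrow> smooth_on U (\<lambda>x. h x + k x)"
  by (simp add: smooth_on_iff_C_inf C_inf_add)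

lemma smooth_on_diff: "open U \<Longrightarrow> smooth_on U h \<Longrightarrow> smooth_on U k \<Longrightarrow> smooth_on U (\<lambda>x. h x - k x)"
  by (simp add: smooth_on_iff_C_inf C_inf_diff)

lemma smooth_on_mult: "open U \<Longrightarrow> smooth_on U h \<Longrightarrow> smooth_on U k \<Longrightarrow> smooth_on U (\<lambda>x. h x * k x)"
  by (simp add: smooth_on_iff_C_inf C_inf_mult)

lemma smooth_on_sum:
  "open U \<Longrightarrow> (\<And>i. i \<in> I \<Longrightarrow> smooth_on U (h i)) \<Longrightarrow> smooth_on U (\<lambda>x. \<Sum>i\<in>I. h i x)"
  by (simp add: smooth_on_iff_C_inf C_inf_sum open_vec_preimage)

text \<open>A function of the coordinates alone is regarded as a function of coordinates and jet
  variables together.\<close>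

lemma C_inf_smooth_on_Inl:
  assumes "open U" "smooth_on U h"
  shows "C_inf {v :: 'n + 'j \<Rightarrow> real. (\<chi> i. v (Inl i)) \<in> U} (\<lambda>v. h (\<chi> i. v (Inl i :: 'n::finite + 'j)))"
  using C_inf_comp_vars[of "{v. (\<chi> i. v i) \<in> U}" "\<lambda>v. h (\<chi> i. v i)" "Inl :: 'n \<Rightarrow> 'n + 'j"] assms
  by (simp add: smooth_on_iff_C_inf comp_def)


section \<open>Lorentzian metrics in a coordinate domain\<close>

text \<open>The normal form is diagonal with entries of modulus one, so its determinant is nonzero;
  multiplicativity passes this to \<open>A\<close>.\<close>

lemma lorentzian_invertible:
  assumes "lorentzian A" shows "invertible A"
proof -
  obtain P :: "real^'a^'a" and i0 where P: "invertible P"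
    "transpose P ** A ** P = (\<chi> i j. if i = j then (if i = i0 then -1 else 1) else 0)"
    using assms by (auto simp: lorentzian_def)
  have "det (transpose P ** A ** P) = (\<Prod>i\<in>UNIV. if i = i0 then -1 else 1)"
    unfolding P(2) by (subst det_diagonal) auto
  also have "\<dots> \<noteq> 0" by (simp add: prod_zero_iff)
  finally show ?thesis by (simp add: det_mul invertible_det_nz)
qed

text \<open>The congruence by \<open>A ** P\<close> brings the inverse to the same normal form to
  which \<open>P\<close> brings \<open>A\<close>, since the factor \<open>A ** matrix_inv A\<close>
  cancels.\<close>

lemma lorentzian_matrix_inv:
  assumes "lorentzian A" shows "lorentzian (matrix_inv A)"
proof -
  obtain P :: "real^'a^'a" and i0 where P: "invertible P"
    "transpose P ** A ** P = (\<chi> i j. if i = j then (if i = i0 then -1 else 1) else 0)" (is "_ = ?E")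
    using assms by (auto simp: lorentzian_def)
  have sym: "transpose A = A" using assms by (simp add: lorentzian_def)
  have inv: "invertible A" by (rule lorentzian_invertible[OF assms])
  let ?B = "matrix_inv A" and ?Q = "A ** P"
  have "transpose ?B = ?B ** A ** transpose ?B"
    by (simp add: inv matrix_inv_left)
  also have "\<dots> = ?B ** transpose (?B ** A)"
    by (simp add: matrix_transpose_mul sym matrix_mul_assoc)
  finally have "transpose ?B = ?B" by (simp add: inv matrix_inv_left)
  moreover have "invertible ?Q" by (intro invertible_mult inv P)
  moreover have "transpose ?Q ** ?B ** ?Q = transpose P ** (A ** ?B) ** A ** P"
    by (simp add: matrix_transpose_mul sym matrix_mul_assoc)
  then have "transpose ?Q ** ?B ** ?Q = ?E"
    by (simp add: inv matrix_inv_right P(2))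
  ultimately show ?thesis unfolding lorentzian_def by blast
qed

lemma ginv_symmetric:
  assumes "lorentzian (gmat g x)" shows "ginv g \<mu> \<nu> x = ginv g \<nu> \<mu> x"
proof -
  have "transpose (matrix_inv (gmat g x)) = matrix_inv (gmat g x)"
    using lorentzian_matrix_inv[OF assms] by (simp add: lorentzian_def)
  then have "transpose (matrix_inv (gmat g x)) $ \<mu> $ \<nu> = matrix_inv (gmat g x) $ \<mu> $ \<nu>"
    by (rule arg_cong)
  then show ?thesis by (simp add: ginv_def transpose_def)
qed

lemma sum_metric_ginv:
  assumes "lorentzian (gmat g x)"
  shows "(\<Sum>\<sigma>\<in>UNIV. g [\<nu>, \<sigma>] x * ginv g \<sigma> \<rho> x) = (if \<nu> = \<rho> then 1 else 0)"
proof -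
  have "(gmat g x ** matrix_inv (gmat g x)) $ \<nu> $ \<rho> = mat 1 $ \<nu> $ \<rho>"
    using assms by (simp add: lorentzian_invertible matrix_inv_right)
  then show ?thesis by (simp add: matrix_matrix_mult_def ginv_def gmat_def mat_def)
qed

lemma sum_ginv_metric:
  assumes "lorentzian (gmat g x)"
  shows "(\<Sum>\<sigma>\<in>UNIV. ginv g \<nu> \<sigma> x * g [\<sigma>, \<rho>] x) = (if \<nu> = \<rho> then 1 else 0)"
proof -
  have "(matrix_inv (gmat g x) ** gmat g x) $ \<nu> $ \<rho> = mat 1 $ \<nu> $ \<rho>"
    using assms by (simp add: lorentzian_invertible matrix_inv_left)
  then show ?thesis by (simp add: matrix_matrix_mult_def ginv_def gmat_def mat_def)
qed

locale metric_on =
  fixes U :: "(real^'n::finite) set" and g :: "'n components"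
  assumes open_U: "open U"
    and smooth_metric: "\<And>\<mu> \<nu>. smooth_on U (g [\<mu>, \<nu>])"
    and lorentzian_metric: "\<And>x. x \<in> U \<Longrightarrow> lorentzian (gmat g x)"
begin

lemma smooth_ginv: "smooth_on U (ginv g \<mu> \<nu>)"
proof -
  have "C_inf {v. (\<chi> i. v i) \<in> U} (\<lambda>v. matrix_inv (gmat g (\<chi> i. v i)) $ \<mu> $ \<nu>)"
    using smooth_metric lorentzian_metric open_U
    by (intro C_inf_matrix_inv)
      (auto simp: gmat_def smooth_on_iff_C_inf lorentzian_invertible simp flip: invertible_det_nz)
  then show ?thesis by (simp add: smooth_on_iff_C_inf open_U ginv_def)
qed

lemma smooth_christoffel: "smooth_on U (christoffel g \<tau> \<mu> \<nu>)"
  unfolding christoffel_def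
  by (intro smooth_on_mult smooth_on_const smooth_on_sum smooth_on_add smooth_on_diff
      smooth_on_pd smooth_ginv smooth_metric open_U)

lemma metric_symmetric: "x \<in> U \<Longrightarrow> g [\<mu>, \<nu>] x = g [\<nu>, \<mu>] x"
  using lorentzian_metric[of x] by (simp add: lorentzian_def gmat_def transpose_def vec_eq_iff)

lemma pd_metric_symmetric: "x \<in> U \<Longrightarrow> pd \<alpha> (g [\<mu>, \<nu>]) x = pd \<alpha> (g [\<nu>, \<mu>]) x"
  by (rule pd_cong[OF open_U]) (auto intro: metric_symmetric)

lemma pd_pd_metric_symmetric: "x \<in> U \<Longrightarrow> pd \<alpha> (pd \<beta> (g [\<mu>, \<nu>])) x = pd \<alpha> (pd \<beta> (g [\<nu>, \<mu>])) x"
  by (rule pd_cong[OF open_U]) (auto intro: pd_metric_symmetric)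

text \<open>Differentiate the identity that the metric times its inverse is the unit matrix, then
  contract with the inverse metric.\<close>

lemma pd_ginv:
  assumes "x \<in> U"
  shows "pd \<alpha> (ginv g \<mu> \<nu>) x =
    - (\<Sum>\<kappa>\<in>UNIV. \<Sum>\<tau>\<in>UNIV. ginv g \<mu> \<kappa> x * pd \<alpha> (g [\<kappa>, \<tau>]) x * ginv g \<tau> \<nu> x)"
proof -
  note L = lorentzian_metric[OF assms]
  have "pd \<alpha> (\<lambda>y. \<Sum>\<tau>\<in>UNIV. g [\<kappa>, \<tau>] y * ginv g \<tau> \<nu> y) x = 0" for \<kappa>
    using pd_cong[OF open_U assms, of "\<lambda>y. \<Sum>\<tau>\<in>UNIV. g [\<kappa>, \<tau>] y * ginv g \<tau> \<nu> y"]
    by (simp add: sum_metric_ginv lorentzian_metric pd_def)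
  moreover have "pd \<alpha> (\<lambda>y. \<Sum>\<tau>\<in>UNIV. g [\<kappa>, \<tau>] y * ginv g \<tau> \<nu> y) x =
      (\<Sum>\<tau>\<in>UNIV. g [\<kappa>, \<tau>] x * pd \<alpha> (ginv g \<tau> \<nu>) x + pd \<alpha> (g [\<kappa>, \<tau>]) x * ginv g \<tau> \<nu> x)" for \<kappa>
    by (rule pd_eqI) (auto intro!: derivative_eq_intros sum.cong
        smooth_on_has_pd[OF open_U smooth_metric assms] smooth_on_has_pd[OF open_U smooth_ginv assms])
  ultimately have *: "(\<Sum>\<tau>\<in>UNIV. g [\<kappa>, \<tau>] x * pd \<alpha> (ginv g \<tau> \<nu>) x) =
      - (\<Sum>\<tau>\<in>UNIV. pd \<alpha> (g [\<kappa>, \<tau>]) x * ginv g \<tau> \<nu> x)" for \<kappa>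
    by (simp add: sum.distrib eq_neg_iff_add_eq_0)
  \<comment> \<open>A Kronecker delta is inserted and rewritten as inverse metric times metric,
    which exposes the sum evaluated in \<open>*\<close>.\<close>
  have "pd \<alpha> (ginv g \<mu> \<nu>) x = (\<Sum>\<tau>\<in>UNIV. (if \<mu> = \<tau> then 1 else 0) * pd \<alpha> (ginv g \<tau> \<nu>) x)"
    by (simp add: mult_delta_left)
  also have "\<dots> = (\<Sum>\<tau>\<in>UNIV. \<Sum>\<kappa>\<in>UNIV. ginv g \<mu> \<kappa> x * (g [\<kappa>, \<tau>] x * pd \<alpha> (ginv g \<tau> \<nu>) x))"
    by (simp only: sum_ginv_metric[OF L, symmetric] sum_distrib_right mult.assoc)
  also have "\<dots> = (\<Sum>\<kappa>\<in>UNIV. ginv g \<mu> \<kappa> x * (\<Sum>\<tau>\<in>UNIV. g [\<kappa>, \<tau>] x * pd \<alpha> (ginv g \<tau> \<nu>) x))"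
    by (subst sum.swap) (simp add: sum_distrib_left)
  finally show ?thesis
    by (simp add: * sum_distrib_left sum_negf mult.assoc)
qed

end

section \<open>The first-order part of the equations as a function of jet variables\<close>

text \<open>
  The background enters through the Christoffel symbols of \<open>gb\<close> instead of the components of
  \<open>gb\<close>: then the non-linearity is polynomial in the background variables and vanishes at zero.
\<close>

datatype 'n background = Conn 'n 'n 'n | Flux 'n 'n 'n

primrec background_fun :: "'n::finite components \<Rightarrow> 'n components \<Rightarrow> 'n background \<Rightarrow> real^'n \<Rightarrow> real" where
  "background_fun gb Hb (Conn \<tau> \<mu> \<nu>) = christoffel gb \<tau> \<mu> \<nu>"
| "background_fun gb Hb (Flux \<mu> \<nu> \<tau>) = Hb [\<mu>, \<nu>, \<tau>]"

type_synonym 'n slots = "'n jet_var + 'n background \<times> 'n list \<Rightarrow> real"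

abbreviation "gval (s :: 'n slots) \<mu> \<nu> \<equiv> s (Inl (Val (G_comp \<mu> \<nu>)))"
abbreviation "gder (s :: 'n slots) \<alpha> \<mu> \<nu> \<equiv> s (Inl (Der \<alpha> (G_comp \<mu> \<nu>)))"
abbreviation "Bval (s :: 'n slots) \<mu> \<nu> \<equiv> s (Inl (Val (B_comp \<mu> \<nu>)))"
abbreviation "Bder (s :: 'n slots) \<alpha> \<mu> \<nu> \<equiv> s (Inl (Der \<alpha> (B_comp \<mu> \<nu>)))"
abbreviation "phival (s :: 'n slots) \<equiv> s (Inl (Val Phi_comp))"
abbreviation "phider (s :: 'n slots) \<alpha> \<equiv> s (Inl (Der \<alpha> Phi_comp))"
abbreviation "conn (s :: 'n slots) \<tau> \<mu> \<nu> \<equiv> s (Inr (Conn \<tau> \<mu> \<nu>, []))"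
abbreviation "conn_der (s :: 'n slots) \<alpha> \<tau> \<mu> \<nu> \<equiv> s (Inr (Conn \<tau> \<mu> \<nu>, [\<alpha>]))"
abbreviation "flux (s :: 'n slots) \<mu> \<nu> \<tau> \<equiv> s (Inr (Flux \<mu> \<nu> \<tau>, []))"
abbreviation "flux_der (s :: 'n slots) \<alpha> \<mu> \<nu> \<tau> \<equiv> s (Inr (Flux \<mu> \<nu> \<tau>, [\<alpha>]))"

text \<open>
  The suffix \<open>1\<close> marks the expression in the jet variables that corresponds to a differential
  expression with all second derivatives of the unknowns set to zero; a prefix \<open>d\<close> marks
  the same for a first derivative, with the differentiation index first.
\<close>

definition ginv1 :: "'n::finite slots \<Rightarrow> 'n \<Rightarrow> 'n \<Rightarrow> real" where
  "ginv1 s \<mu> \<nu> = matrix_inv (\<chi> \<alpha> \<beta>. gval s \<alpha> \<beta>) $ \<mu> $ \<nu>"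

definition dginv1 :: "'n::finite slots \<Rightarrow> 'n \<Rightarrow> 'n \<Rightarrow> 'n \<Rightarrow> real" where
  "dginv1 s \<alpha> \<mu> \<nu> = - (\<Sum>\<kappa>\<in>UNIV. \<Sum>\<tau>\<in>UNIV. ginv1 s \<mu> \<kappa> * gder s \<alpha> \<kappa> \<tau> * ginv1 s \<tau> \<nu>)"

definition chr1 :: "'n::finite slots \<Rightarrow> 'n \<Rightarrow> 'n \<Rightarrow> 'n \<Rightarrow> real" where
  "chr1 s \<tau> \<mu> \<nu> = 1/2 * (\<Sum>\<sigma>\<in>UNIV. ginv1 s \<tau> \<sigma> * (gder s \<mu> \<nu> \<sigma> + gder s \<nu> \<mu> \<sigma> - gder s \<sigma> \<mu> \<nu>))"

definition dchr1 :: "'n::finite slots \<Rightarrow> 'n \<Rightarrow> 'n \<Rightarrow> 'n \<Rightarrow> 'n \<Rightarrow> real" where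
  "dchr1 s \<rho> \<tau> \<mu> \<nu> =
     1/2 * (\<Sum>\<sigma>\<in>UNIV. dginv1 s \<rho> \<tau> \<sigma> * (gder s \<mu> \<nu> \<sigma> + gder s \<nu> \<mu> \<sigma> - gder s \<sigma> \<mu> \<nu>))"

definition ricci1 :: "'n::finite slots \<Rightarrow> 'n \<Rightarrow> 'n \<Rightarrow> real" where
  "ricci1 s \<mu> \<nu> = (\<Sum>\<rho>\<in>UNIV. dchr1 s \<rho> \<rho> \<nu> \<mu> - dchr1 s \<nu> \<rho> \<rho> \<mu> +
     (\<Sum>\<tau>\<in>UNIV. chr1 s \<rho> \<rho> \<tau> * chr1 s \<tau> \<nu> \<mu> - chr1 s \<rho> \<nu> \<tau> * chr1 s \<tau> \<rho> \<mu>))"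

definition gauge_D1 :: "'n::finite slots \<Rightarrow> 'n \<Rightarrow> real" where
  "gauge_D1 s \<nu> = - (\<Sum>\<mu>\<in>UNIV. \<Sum>\<alpha>\<in>UNIV. \<Sum>\<beta>\<in>UNIV.
     gval s \<nu> \<mu> * ginv1 s \<alpha> \<beta> * (chr1 s \<mu> \<alpha> \<beta> - conn s \<mu> \<alpha> \<beta>))"

definition dgauge_D1 :: "'n::finite slots \<Rightarrow> 'n \<Rightarrow> 'n \<Rightarrow> real" where
  "dgauge_D1 s \<rho> \<nu> = - (\<Sum>\<mu>\<in>UNIV. \<Sum>\<alpha>\<in>UNIV. \<Sum>\<beta>\<in>UNIV.
     (gder s \<rho> \<nu> \<mu> * ginv1 s \<alpha> \<beta> + gval s \<nu> \<mu> * dginv1 s \<rho> \<alpha> \<beta>) * (chr1 s \<mu> \<alpha> \<beta> - conn s \<mu> \<alpha> \<beta>) +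
     gval s \<nu> \<mu> * ginv1 s \<alpha> \<beta> * (dchr1 s \<rho> \<mu> \<alpha> \<beta> - conn_der s \<rho> \<mu> \<alpha> \<beta>))"

definition nabla_D1 :: "'n::finite slots \<Rightarrow> 'n \<Rightarrow> 'n \<Rightarrow> real" where
  "nabla_D1 s \<mu> \<nu> = dgauge_D1 s \<mu> \<nu> - (\<Sum>\<tau>\<in>UNIV. chr1 s \<tau> \<mu> \<nu> * gauge_D1 s \<tau>)"

definition extd_B1 :: "'n slots \<Rightarrow> 'n \<Rightarrow> 'n \<Rightarrow> 'n \<Rightarrow> real" where
  "extd_B1 s \<mu> \<nu> \<tau> = Bder s \<mu> \<nu> \<tau> - Bder s \<nu> \<mu> \<tau> + Bder s \<tau> \<mu> \<nu>"

definition strength1 :: "'n slots \<Rightarrow> 'n \<Rightarrow> 'n \<Rightarrow> 'n \<Rightarrow> real" where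
  "strength1 s \<mu> \<nu> \<tau> = flux s \<mu> \<nu> \<tau> + extd_B1 s \<mu> \<nu> \<tau>"

text \<open>The connection terms of the codifferential of a three-form, with the derivative of
  \<open>A\<close> left out. That derivative is of second order in \<open>B\<close> for the exterior
  derivative of \<open>B\<close>, but is a background variable for the flux, so the two cases are
  completed differently.\<close>

definition codiff_chr1 :: "'n::finite slots \<Rightarrow> ('n \<Rightarrow> 'n \<Rightarrow> 'n \<Rightarrow> real) \<Rightarrow> 'n \<Rightarrow> 'n \<Rightarrow> real" where
  "codiff_chr1 s A \<mu> \<nu> = (\<Sum>\<kappa>\<in>UNIV. \<Sum>\<tau>\<in>UNIV. ginv1 s \<kappa> \<tau> *
     ((\<Sum>\<rho>\<in>UNIV. chr1 s \<rho> \<kappa> \<tau> * A \<rho> \<mu> \<nu>) + (\<Sum>\<rho>\<in>UNIV. chr1 s \<rho> \<kappa> \<mu> * A \<tau> \<rho> \<nu>) +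
      (\<Sum>\<rho>\<in>UNIV. chr1 s \<rho> \<kappa> \<nu> * A \<tau> \<mu> \<rho>)))"

definition dgauge_C1 :: "'n::finite slots \<Rightarrow> 'n \<Rightarrow> 'n \<Rightarrow> real" where
  "dgauge_C1 s \<mu> \<nu> = - (\<Sum>\<kappa>\<in>UNIV. \<Sum>\<tau>\<in>UNIV.
     dginv1 s \<mu> \<kappa> \<tau> * (Bder s \<kappa> \<tau> \<nu> -
       ((\<Sum>\<rho>\<in>UNIV. conn s \<rho> \<kappa> \<tau> * Bval s \<rho> \<nu>) + (\<Sum>\<rho>\<in>UNIV. conn s \<rho> \<kappa> \<nu> * Bval s \<tau> \<rho>))) -
     ginv1 s \<kappa> \<tau> *
       ((\<Sum>\<rho>\<in>UNIV. conn_der s \<mu> \<rho> \<kappa> \<tau> * Bval s \<rho> \<nu> + conn s \<rho> \<kappa> \<tau> * Bder s \<mu> \<rho> \<nu>) +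
        (\<Sum>\<rho>\<in>UNIV. conn_der s \<mu> \<rho> \<kappa> \<nu> * Bval s \<tau> \<rho> + conn s \<rho> \<kappa> \<nu> * Bder s \<mu> \<tau> \<rho>)))"

definition Hsq1 :: "'n::finite slots \<Rightarrow> 'n \<Rightarrow> 'n \<Rightarrow> real" where
  "Hsq1 s \<mu> \<nu> = (\<Sum>\<kappa>\<in>UNIV. \<Sum>\<tau>\<in>UNIV. \<Sum>\<omega>\<in>UNIV. \<Sum>\<pi>\<in>UNIV.
     ginv1 s \<kappa> \<tau> * ginv1 s \<omega> \<pi> * strength1 s \<mu> \<kappa> \<omega> * strength1 s \<nu> \<tau> \<pi>)"

definition Hnorm1 :: "'n::finite slots \<Rightarrow> real" where
  "Hnorm1 s = (\<Sum>\<mu>\<in>UNIV. \<Sum>\<nu>\<in>UNIV. \<Sum>\<tau>\<in>UNIV. \<Sum>\<alpha>\<in>UNIV. \<Sum>\<beta>\<in>UNIV. \<Sum>\<gamma>\<in>UNIV.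
     ginv1 s \<mu> \<alpha> * ginv1 s \<nu> \<beta> * ginv1 s \<tau> \<gamma> * strength1 s \<mu> \<nu> \<tau> * strength1 s \<alpha> \<beta> \<gamma>)"

definition dilaton1 :: "'n::finite slots \<Rightarrow> real" where
  "dilaton1 s = exp (- 4 * (1 / (real CARD('n) - 2)) * phival s)"

primrec lhs1 :: "'n::finite slots \<Rightarrow> 'n unknown \<Rightarrow> real" where
  "lhs1 s (G_comp \<mu> \<nu>) = ricci1 s \<mu> \<nu> + 1/2 * (nabla_D1 s \<mu> \<nu> + nabla_D1 s \<nu> \<mu>)"
| "lhs1 s (B_comp \<mu> \<nu>) = - codiff_chr1 s (extd_B1 s) \<mu> \<nu> - (dgauge_C1 s \<mu> \<nu> - dgauge_C1 s \<nu> \<mu>)"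
| "lhs1 s Phi_comp = - (\<Sum>\<mu>\<in>UNIV. \<Sum>\<nu>\<in>UNIV. ginv1 s \<mu> \<nu> * (\<Sum>\<tau>\<in>UNIV. chr1 s \<tau> \<mu> \<nu> * phider s \<tau>))"

primrec rhs1 :: "'n::finite slots \<Rightarrow> 'n unknown \<Rightarrow> real" where
  "rhs1 s (G_comp \<mu> \<nu>) = 1 / (real CARD('n) - 2) *
      (phider s \<mu> * phider s \<nu> - dilaton1 s / 6 * Hnorm1 s * gval s \<mu> \<nu>)
      + dilaton1 s * (Hsq1 s \<mu> \<nu> / 4)"
| "rhs1 s (B_comp \<mu> \<nu>) =
      codiff_chr1 s (flux s) \<mu> \<nu> - (\<Sum>\<kappa>\<in>UNIV. \<Sum>\<tau>\<in>UNIV. ginv1 s \<kappa> \<tau> * flux_der s \<kappa> \<tau> \<mu> \<nu>)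
      + 4 / (real CARD('n) - 2) *
        (\<Sum>\<kappa>\<in>UNIV. \<Sum>\<tau>\<in>UNIV. ginv1 s \<kappa> \<tau> * phider s \<kappa> * strength1 s \<tau> \<mu> \<nu>)"
| "rhs1 s Phi_comp = - (dilaton1 s / 6 * Hnorm1 s)"

text \<open>The Ricci equation has principal part \<open>-1/2\<close> times the wave operator, hence
  the factor \<open>-2\<close>; the other two equations are already normalised. The first-order
  left-hand side changes sign because only the wave operator stays on the left.\<close>

definition nonlinearity :: "'n::finite slots \<Rightarrow> 'n unknown \<Rightarrow> real" where
  "nonlinearity s k = eq_const (- 2) 1 1 k * (rhs1 s k - lhs1 s k)"

lemmas first_order_defs = dginv1_def chr1_def dchr1_def ricci1_def gauge_D1_def dgauge_D1_def
  nabla_D1_def extd_B1_def strength1_def codiff_chr1_def dgauge_C1_def Hsq1_def Hnorm1_def dilaton1_def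

text \<open>Undifferentiated metric values and the dilaton exponential occur only as coefficients:
  the exponential multiplies expressions quadratic in the field strength, and the remaining terms
  contain a metric derivative, a component or derivative of \<open>B\<close>, a derivative of the
  dilaton, or a background slot.\<close>

lemma nonlinearity_eq_0:
  assumes "\<And>\<alpha> \<mu> \<nu>. gder s \<alpha> \<mu> \<nu> = 0" "\<And>\<mu> \<nu>. Bval s \<mu> \<nu> = 0" "\<And>\<alpha> \<mu> \<nu>. Bder s \<alpha> \<mu> \<nu> = 0"
    and "\<And>\<alpha>. phider s \<alpha> = 0" "\<And>\<beta>. s (Inr (\<beta>, [])) = 0" "\<And>\<alpha> \<beta>. s (Inr (\<beta>, [\<alpha>])) = 0"
  shows "nonlinearity s k = 0"
  by (cases k) (simp_all add: nonlinearity_def first_order_defs assms)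

text \<open>Only sums, products, an exponential and the inverse matrix occur. Letting the slots
  depend on \<open>v\<close> covers both parametrisations used later, by coordinates and by free
  background variables. The determinant condition replaces the Lorentzian one because it is
  open.\<close>

lemma C_inf_nonlinearity:
  assumes s: "\<And>z. C_inf W (\<lambda>v. s v z)"
    and det: "\<And>v. v \<in> W \<Longrightarrow> det (\<chi> \<alpha> \<beta>. gval (s v) \<alpha> \<beta> :: real^'n^'n) \<noteq> 0"
  shows "C_inf W (\<lambda>v. nonlinearity (s v :: 'n::finite slots) k)"
proof -
  have W: "open W" using s by (simp add: C_inf_def)
  note rules = C_inf_const[OF W] C_inf_add C_inf_diff C_inf_uminus C_inf_mult C_inf_sum[OF W] s
  have ginv: "C_inf W (\<lambda>v. ginv1 (s v) \<mu> \<nu>)" for \<mu> \<nu>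
    unfolding ginv1_def by (rule C_inf_matrix_inv) (simp_all add: s det)
  have dginv: "C_inf W (\<lambda>v. dginv1 (s v) \<alpha> \<mu> \<nu>)" for \<alpha> \<mu> \<nu>
    unfolding dginv1_def by (intro rules ginv)
  have chr: "C_inf W (\<lambda>v. chr1 (s v) \<alpha> \<mu> \<nu>)" for \<alpha> \<mu> \<nu>
    unfolding chr1_def by (intro rules ginv)
  have dchr: "C_inf W (\<lambda>v. dchr1 (s v) \<rho> \<alpha> \<mu> \<nu>)" for \<rho> \<alpha> \<mu> \<nu>
    unfolding dchr1_def by (intro rules dginv)
  have nabla_D: "C_inf W (\<lambda>v. nabla_D1 (s v) \<mu> \<nu>)" for \<mu> \<nu>
    unfolding nabla_D1_def dgauge_D1_def gauge_D1_def by (intro rules ginv dginv chr dchr)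
  have ricci: "C_inf W (\<lambda>v. ricci1 (s v) \<mu> \<nu>)" for \<mu> \<nu>
    unfolding ricci1_def by (intro rules chr dchr)
  have extd: "C_inf W (\<lambda>v. extd_B1 (s v) \<alpha> \<mu> \<nu>)" for \<alpha> \<mu> \<nu>
    unfolding extd_B1_def by (intro rules)
  have strength: "C_inf W (\<lambda>v. strength1 (s v) \<alpha> \<mu> \<nu>)" for \<alpha> \<mu> \<nu>
    unfolding strength1_def by (intro rules extd)
  have codiff: "C_inf W (\<lambda>v. codiff_chr1 (s v) (A v) \<mu> \<nu>)"
    if "\<And>\<rho> \<mu> \<nu>. C_inf W (\<lambda>v. A v \<rho> \<mu> \<nu>)" for A \<mu> \<nu>
    unfolding codiff_chr1_def by (intro rules ginv chr that)
  have dgauge_C: "C_inf W (\<lambda>v. dgauge_C1 (s v) \<mu> \<nu>)" for \<mu> \<nu>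
    unfolding dgauge_C1_def by (intro rules ginv dginv)
  have Hsq: "C_inf W (\<lambda>v. Hsq1 (s v) \<mu> \<nu>)" for \<mu> \<nu>
    unfolding Hsq1_def by (intro rules ginv strength)
  have Hnorm: "C_inf W (\<lambda>v. Hnorm1 (s v))"
    unfolding Hnorm1_def by (intro rules ginv strength)
  have dil: "C_inf W (\<lambda>v. dilaton1 (s v))"
    unfolding dilaton1_def by (intro C_inf_exp rules)
  have [intro]: "C_inf W F \<Longrightarrow> C_inf W (\<lambda>v. F v / c)" for F c
    using C_inf_mult[OF _ C_inf_const[OF W, of "1 / c"]] by simp
  have "C_inf W (\<lambda>v. lhs1 (s v) k)"
    by (cases k) (auto intro!: rules ginv chr nabla_D ricci extd codiff dgauge_C)
  moreover have "C_inf W (\<lambda>v. rhs1 (s v) k)"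
    by (cases k) (auto intro!: rules ginv codiff strength Hsq Hnorm dil)
  ultimately show ?thesis
    unfolding nonlinearity_def by (intro rules)
qed

section \<open>Second-order part of the equations\<close>

definition slots_at ::
  "'n::finite components \<Rightarrow> 'n components \<Rightarrow> 'n components \<Rightarrow> 'n components \<Rightarrow> 'n components \<Rightarrow>
    real^'n \<Rightarrow> 'n slots" where
  "slots_at gb Hb g B \<phi> x =
    case_sum (jet g B \<phi> x) (\<lambda>(\<beta>, \<alpha>). pds \<alpha> (background_fun gb Hb \<beta>) x)"

lemma slots_at_simps [simp]:
  "slots_at gb Hb g B \<phi> x (Inl y) = jet g B \<phi> x y"
  "slots_at gb Hb g B \<phi> x (Inr (\<beta>, \<alpha>)) = pds \<alpha> (background_fun gb Hb \<beta>) x"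
  by (simp_all add: slots_at_def)

lemma extd_0: "extd A [\<mu>] x = pd \<mu> (A []) x"
  by (simp add: extd_def)

lemma extd_1: "extd A [\<mu>, \<nu>] x = pd \<mu> (A [\<nu>]) x - pd \<nu> (A [\<mu>]) x"
  by (simp add: extd_def)

lemma extd_2: "extd A [\<mu>, \<nu>, \<tau>] x = pd \<mu> (A [\<nu>, \<tau>]) x - pd \<nu> (A [\<mu>, \<tau>]) x + pd \<tau> (A [\<mu>, \<nu>]) x"
  by (simp add: extd_def)

text \<open>Brings the index lowered by the metric to the innermost sum, where metric and inverse
  metric contract to a delta.\<close>

lemma sum_rotate:
  "(\<Sum>\<mu>\<in>A. \<Sum>\<alpha>\<in>B. \<Sum>\<beta>\<in>C. \<Sum>\<sigma>\<in>D. t \<mu> \<alpha> \<beta> \<sigma>) = (\<Sum>\<alpha>\<in>B. \<Sum>\<beta>\<in>C. \<Sum>\<sigma>\<in>D. \<Sum>\<mu>\<in>A. t \<mu> \<alpha> \<beta> \<sigma>)"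
proof -
  have "(\<Sum>\<mu>\<in>A. \<Sum>\<alpha>\<in>B. \<Sum>\<beta>\<in>C. \<Sum>\<sigma>\<in>D. t \<mu> \<alpha> \<beta> \<sigma>) = (\<Sum>\<alpha>\<in>B. \<Sum>\<mu>\<in>A. \<Sum>\<beta>\<in>C. \<Sum>\<sigma>\<in>D. t \<mu> \<alpha> \<beta> \<sigma>)"
    by (rule sum.swap)
  also have "\<dots> = (\<Sum>\<alpha>\<in>B. \<Sum>\<beta>\<in>C. \<Sum>\<mu>\<in>A. \<Sum>\<sigma>\<in>D. t \<mu> \<alpha> \<beta> \<sigma>)"
    by (rule sum.cong[OF refl], rule sum.swap)
  also have "\<dots> = (\<Sum>\<alpha>\<in>B. \<Sum>\<beta>\<in>C. \<Sum>\<sigma>\<in>D. \<Sum>\<mu>\<in>A. t \<mu> \<alpha> \<beta> \<sigma>)"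
    by (rule sum.cong[OF refl], rule sum.cong[OF refl], rule sum.swap)
  finally show ?thesis .
qed

lemma sum_swap_symmetric:
  assumes "\<And>\<alpha> \<beta>. a \<alpha> \<beta> = a \<beta> \<alpha>"
  shows "(\<Sum>\<alpha>\<in>UNIV. \<Sum>\<beta>\<in>UNIV. a \<alpha> \<beta> * h \<beta> \<alpha>) = (\<Sum>\<alpha>\<in>UNIV. \<Sum>\<beta>\<in>UNIV. a \<alpha> \<beta> * (h \<alpha> \<beta> :: real))"
  by (subst sum.swap) (simp add: assms)

text \<open>Despite the name no field equation is assumed: the locale describes arbitrary smooth
  fields on a patch, and the identities below hold off shell. The background metric appears only
  through its Christoffel symbols.\<close>

locale solution_on = metric_on U g for U :: "(real^'n::finite) set" and g +
  fixes gb Hb B \<phi> :: "'n components"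
  assumes smooth_conn: "\<And>\<tau> \<mu> \<nu>. smooth_on U (christoffel gb \<tau> \<mu> \<nu>)"
    and smooth_flux: "\<And>\<mu> \<nu> \<tau>. smooth_on U (Hb [\<mu>, \<nu>, \<tau>])"
    and smooth_B: "\<And>\<mu> \<nu>. smooth_on U (B [\<mu>, \<nu>])"
    and smooth_phi: "smooth_on U (\<phi> [])"
begin

context
  fixes x assumes x: "x \<in> U"
begin

abbreviation "S \<equiv> slots_at gb Hb g B \<phi> x"
abbreviation "gg \<mu> \<nu> \<equiv> ginv g \<mu> \<nu> x"
abbreviation "h \<alpha> \<beta> \<mu> \<nu> \<equiv> pd \<alpha> (pd \<beta> (g [\<mu>, \<nu>])) x"

lemmas has_pd_intros =
  smooth_on_has_pd[OF open_U smooth_metric x] smooth_on_has_pd[OF open_U smooth_ginv x]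
  smooth_on_has_pd[OF open_U smooth_on_pd[OF open_U smooth_metric] x] smooth_on_has_pd[OF open_U smooth_christoffel x]
  smooth_on_has_pd[OF open_U smooth_conn x] smooth_on_has_pd[OF open_U smooth_B x]
  smooth_on_has_pd[OF open_U smooth_on_pd[OF open_U smooth_B] x]

section \<open>First-order expressions evaluated on actual fields\<close>

lemma ginv1_at: "ginv1 S \<mu> \<nu> = gg \<mu> \<nu>"
  by (simp add: ginv1_def ginv_def gmat_def)

lemma dginv1_at: "dginv1 S \<alpha> \<mu> \<nu> = pd \<alpha> (ginv g \<mu> \<nu>) x"
  by (simp add: dginv1_def pd_ginv[OF x] ginv1_at)

lemma chr1_at: "chr1 S \<tau> \<mu> \<nu> = christoffel g \<tau> \<mu> \<nu> x"
  by (simp add: chr1_def christoffel_def ginv1_at)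

text \<open>Product rule: a derivative falling on the inverse metric leaves a first-order term,
  collected in \<open>dchr1\<close>; otherwise second derivatives of the metric arise.\<close>

lemma pd_christoffel:
  "pd \<rho> (christoffel g \<tau> \<mu> \<nu>) x =
    1/2 * (\<Sum>\<sigma>\<in>UNIV. gg \<tau> \<sigma> * (h \<rho> \<mu> \<nu> \<sigma> + h \<rho> \<nu> \<mu> \<sigma> - h \<rho> \<sigma> \<mu> \<nu>)) + dchr1 S \<rho> \<tau> \<mu> \<nu>"
  unfolding christoffel_def dchr1_def dginv1_at
  by (rule pd_eqI)
    (auto intro!: derivative_eq_intros has_pd_intros
      simp: sum.distrib sum_subtractf add_divide_distrib algebra_simps)

section \<open>Principal parts of the gauge term, the Ricci tensor and the scalar wave
  operator\<close>

lemma gauge_D1_at: "gauge_D1 S \<nu> = gauge_D gb g [\<nu>] x"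
  by (simp add: gauge_D1_def gauge_D_def ginv1_at chr1_at)

text \<open>Second derivatives of the metric arise only when the derivative hits the Christoffel
  symbols of \<open>g\<close>; derivatives of the background connection remain in
  \<open>dgauge_D1\<close>.\<close>

lemma pd_gauge_D:
  "pd \<rho> (gauge_D gb g [\<nu>]) x =
    - (1/2 * (\<Sum>\<alpha>\<in>UNIV. \<Sum>\<beta>\<in>UNIV. gg \<alpha> \<beta> * (h \<rho> \<alpha> \<beta> \<nu> + h \<rho> \<beta> \<alpha> \<nu> - h \<rho> \<nu> \<alpha> \<beta>)))
    + dgauge_D1 S \<rho> \<nu>"
proof -
  have "pd \<rho> (gauge_D gb g [\<nu>]) x = - (\<Sum>\<mu>\<in>UNIV. \<Sum>\<alpha>\<in>UNIV. \<Sum>\<beta>\<in>UNIV.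
     (pd \<rho> (g [\<nu>, \<mu>]) x * gg \<alpha> \<beta> + g [\<nu>, \<mu>] x * pd \<rho> (ginv g \<alpha> \<beta>) x) *
       (christoffel g \<mu> \<alpha> \<beta> x - christoffel gb \<mu> \<alpha> \<beta> x) +
     g [\<nu>, \<mu>] x * gg \<alpha> \<beta> * (pd \<rho> (christoffel g \<mu> \<alpha> \<beta>) x - pd \<rho> (christoffel gb \<mu> \<alpha> \<beta>) x))"
    unfolding gauge_D_def
    by (rule pd_eqI) (auto intro!: derivative_eq_intros has_pd_intros sum.cong simp: algebra_simps)
  also have "\<dots> = - (\<Sum>\<mu>\<in>UNIV. \<Sum>\<alpha>\<in>UNIV. \<Sum>\<beta>\<in>UNIV. g [\<nu>, \<mu>] x * gg \<alpha> \<beta> *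
      (1/2 * (\<Sum>\<sigma>\<in>UNIV. gg \<mu> \<sigma> * (h \<rho> \<alpha> \<beta> \<sigma> + h \<rho> \<beta> \<alpha> \<sigma> - h \<rho> \<sigma> \<alpha> \<beta>)))) + dgauge_D1 S \<rho> \<nu>"
    by (simp add: pd_christoffel dgauge_D1_def ginv1_at chr1_at dginv1_at
        sum.distrib[symmetric] sum_negf[symmetric] del: sum_negf)
      (simp add: algebra_simps)
  \<comment> \<open>The contraction over \<open>\<mu>\<close> is isolated so that
    \<open>g [\<nu>, \<mu>]\<close> cancels the inverse metric inside the Christoffel
    symbol.\<close>
  also have "(\<Sum>\<mu>\<in>UNIV. \<Sum>\<alpha>\<in>UNIV. \<Sum>\<beta>\<in>UNIV. g [\<nu>, \<mu>] x * gg \<alpha> \<beta> *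
      (1/2 * (\<Sum>\<sigma>\<in>UNIV. gg \<mu> \<sigma> * (h \<rho> \<alpha> \<beta> \<sigma> + h \<rho> \<beta> \<alpha> \<sigma> - h \<rho> \<sigma> \<alpha> \<beta>)))) =
      (\<Sum>\<alpha>\<in>UNIV. \<Sum>\<beta>\<in>UNIV. \<Sum>\<sigma>\<in>UNIV. \<Sum>\<mu>\<in>UNIV. 1/2 * gg \<alpha> \<beta> *
        (h \<rho> \<alpha> \<beta> \<sigma> + h \<rho> \<beta> \<alpha> \<sigma> - h \<rho> \<sigma> \<alpha> \<beta>) * (g [\<nu>, \<mu>] x * gg \<mu> \<sigma>))"
    unfolding sum_distrib_left by (subst sum_rotate) (simp only: mult_ac)
  also have "\<dots> = 1/2 * (\<Sum>\<alpha>\<in>UNIV. \<Sum>\<beta>\<in>UNIV. gg \<alpha> \<beta> * (h \<rho> \<alpha> \<beta> \<nu> + h \<rho> \<beta> \<alpha> \<nu> - h \<rho> \<nu> \<alpha> \<beta>))"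
    unfolding sum_distrib_left[symmetric] sum_metric_ginv[OF lorentzian_metric[OF x]]
    by (simp add: mult_delta_left mult_delta_right sum.distrib sum_subtractf
        sum_divide_distrib[symmetric] algebra_simps)
  finally show ?thesis .
qed


lemma h_commute: "h \<alpha> \<beta> \<mu> \<nu> = h \<beta> \<alpha> \<mu> \<nu>"
  by (rule pd_commute[OF open_U smooth_metric x])

lemma h_symmetric: "h \<alpha> \<beta> \<mu> \<nu> = h \<alpha> \<beta> \<nu> \<mu>"
  by (rule pd_pd_metric_symmetric[OF x])

lemma gg_symmetric: "gg \<mu> \<nu> = gg \<nu> \<mu>"
  by (rule ginv_symmetric[OF lorentzian_metric[OF x]])

text \<open>Of the six second-derivative terms in the contracted curvature,
  \<open>h \<alpha> \<nu> \<mu> \<beta>\<close> and \<open>h \<nu> \<alpha> \<mu> \<beta>\<close>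
  cancel because partial derivatives commute. Four survive: one gives the wave operator, and the
  other three are left for the gauge term to remove.\<close>

lemma ricci_at:
  "ricci g \<mu> \<nu> x = ricci1 S \<mu> \<nu> + 1/2 * (\<Sum>\<alpha>\<in>UNIV. \<Sum>\<beta>\<in>UNIV. gg \<alpha> \<beta> *
    (h \<mu> \<alpha> \<beta> \<nu> + h \<nu> \<alpha> \<beta> \<mu> - h \<alpha> \<beta> \<mu> \<nu> - h \<mu> \<nu> \<alpha> \<beta>))"
proof -
  have "ricci g \<mu> \<nu> x = ricci1 S \<mu> \<nu> + 1/2 * (\<Sum>\<alpha>\<in>UNIV. \<Sum>\<beta>\<in>UNIV. gg \<alpha> \<beta> *
      (h \<alpha> \<nu> \<mu> \<beta> + h \<alpha> \<mu> \<nu> \<beta> - h \<alpha> \<beta> \<nu> \<mu> - (h \<nu> \<alpha> \<mu> \<beta> + h \<nu> \<mu> \<alpha> \<beta> - h \<nu> \<beta> \<alpha> \<mu>)))"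
    unfolding ricci_def riemann_def ricci1_def chr1_at pd_christoffel
    by (simp add: sum.distrib sum_subtractf right_diff_distrib distrib_left sum_divide_distrib[symmetric])
  also have "(\<Sum>\<alpha>\<in>UNIV. \<Sum>\<beta>\<in>UNIV. gg \<alpha> \<beta> *
      (h \<alpha> \<nu> \<mu> \<beta> + h \<alpha> \<mu> \<nu> \<beta> - h \<alpha> \<beta> \<nu> \<mu> - (h \<nu> \<alpha> \<mu> \<beta> + h \<nu> \<mu> \<alpha> \<beta> - h \<nu> \<beta> \<alpha> \<mu>))) =
      (\<Sum>\<alpha>\<in>UNIV. \<Sum>\<beta>\<in>UNIV. gg \<alpha> \<beta> * (h \<mu> \<alpha> \<beta> \<nu> - h \<alpha> \<beta> \<mu> \<nu> - h \<mu> \<nu> \<alpha> \<beta>)) +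
      (\<Sum>\<alpha>\<in>UNIV. \<Sum>\<beta>\<in>UNIV. gg \<alpha> \<beta> * h \<nu> \<beta> \<alpha> \<mu>)"
    unfolding sum.distrib[symmetric]
  proof (intro sum.cong refl)
    fix \<alpha> \<beta>
    have "h \<alpha> \<nu> \<mu> \<beta> = h \<nu> \<alpha> \<mu> \<beta>" "h \<alpha> \<mu> \<nu> \<beta> = h \<mu> \<alpha> \<beta> \<nu>" "h \<alpha> \<beta> \<nu> \<mu> = h \<alpha> \<beta> \<mu> \<nu>"
      "h \<nu> \<mu> \<alpha> \<beta> = h \<mu> \<nu> \<alpha> \<beta>"
      using h_commute h_symmetric by metis+
    then show "gg \<alpha> \<beta> *
        (h \<alpha> \<nu> \<mu> \<beta> + h \<alpha> \<mu> \<nu> \<beta> - h \<alpha> \<beta> \<nu> \<mu> - (h \<nu> \<alpha> \<mu> \<beta> + h \<nu> \<mu> \<alpha> \<beta> - h \<nu> \<beta> \<alpha> \<mu>)) =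
        gg \<alpha> \<beta> * (h \<mu> \<alpha> \<beta> \<nu> - h \<alpha> \<beta> \<mu> \<nu> - h \<mu> \<nu> \<alpha> \<beta>) + gg \<alpha> \<beta> * h \<nu> \<beta> \<alpha> \<mu>"
      by (simp add: algebra_simps)
  qed
  \<comment> \<open>Renaming the summation indices and using the symmetry of the inverse metric
    gives this term the shape of its \<open>\<mu>\<close>-counterpart.\<close>
  also have "(\<Sum>\<alpha>\<in>UNIV. \<Sum>\<beta>\<in>UNIV. gg \<alpha> \<beta> * h \<nu> \<beta> \<alpha> \<mu>) = (\<Sum>\<alpha>\<in>UNIV. \<Sum>\<beta>\<in>UNIV. gg \<alpha> \<beta> * h \<nu> \<alpha> \<beta> \<mu>)"
    by (rule sum_swap_symmetric[of gg "\<lambda>\<alpha> \<beta>. h \<nu> \<alpha> \<beta> \<mu>", OF gg_symmetric])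
  finally show ?thesis
    by (simp add: sum.distrib sum_subtractf algebra_simps)
qed

lemma nabla_D_at:
  "nabla (christoffel g) (gauge_D gb g) [\<mu>, \<nu>] x = nabla_D1 S \<mu> \<nu>
    - (\<Sum>\<alpha>\<in>UNIV. \<Sum>\<beta>\<in>UNIV. gg \<alpha> \<beta> * (h \<mu> \<alpha> \<beta> \<nu> - 1/2 * h \<mu> \<nu> \<alpha> \<beta>))"
proof -
  have "(\<Sum>\<alpha>\<in>UNIV. \<Sum>\<beta>\<in>UNIV. gg \<alpha> \<beta> * h \<mu> \<beta> \<alpha> \<nu>) = (\<Sum>\<alpha>\<in>UNIV. \<Sum>\<beta>\<in>UNIV. gg \<alpha> \<beta> * h \<mu> \<alpha> \<beta> \<nu>)"
    by (rule sum_swap_symmetric[of gg "\<lambda>\<alpha> \<beta>. h \<mu> \<alpha> \<beta> \<nu>", OF gg_symmetric])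
  then show ?thesis
    by (simp add: pd_gauge_D nabla_D1_def chr1_at gauge_D1_at sum.distrib sum_subtractf
        sum_divide_distrib[symmetric] algebra_simps)
qed

text \<open>In the symmetrised gauge term the two trace terms
  \<open>h \<mu> \<nu> \<alpha> \<beta>\<close> and \<open>h \<nu> \<mu> \<alpha> \<beta>\<close>
  combine, and together with the divergence terms they cancel everything in \<open>ricci_at\<close>
  but the wave operator.\<close>

lemma ricci_hat_at:
  "ricci_hat gb g \<mu> \<nu> x = lhs1 S (G_comp \<mu> \<nu>) - 1/2 * wave_part g (g [\<mu>, \<nu>]) x"
proof -
  have "wave_part g (g [\<mu>, \<nu>]) x = (\<Sum>\<alpha>\<in>UNIV. \<Sum>\<beta>\<in>UNIV. gg \<alpha> \<beta> * h \<alpha> \<beta> \<mu> \<nu>)"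
    by (simp add: wave_part_def)
  then show ?thesis
    unfolding ricci_hat_def ricci_at nabla_D_at
    by (simp add: h_commute[of \<nu> \<mu>] sum.distrib sum_subtractf sum_divide_distrib[symmetric] algebra_simps)
qed

lemma box_phi_at: "box g \<phi> [] x = lhs1 S Phi_comp + wave_part g (\<phi> []) x"
proof -
  have "nabla (christoffel g) \<phi> [\<nu>] = pd \<nu> (\<phi> [])" for \<nu>
    by (simp add: fun_eq_iff)
  then show ?thesis
    by (simp add: box_def wave_part_def ginv1_at chr1_at algebra_simps sum_subtractf)
qed

section \<open>The codifferential and the gauge term in the equation for the two-form\<close>

lemma strength1_at: "strength1 S \<mu> \<nu> \<tau> = field_strength Hb B [\<mu>, \<nu>, \<tau>] x"
  by (simp add: strength1_def extd_B1_def field_strength_def extd_2)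

text \<open>Stated for general \<open>A\<close> because it serves both the exterior derivative of
  \<open>B\<close> and the background flux.\<close>

lemma codiff_3:
  "codiff g A [\<mu>, \<nu>] x = codiff_chr1 S (\<lambda>\<rho> \<mu> \<nu>. A [\<rho>, \<mu>, \<nu>] x) \<mu> \<nu>
    - (\<Sum>\<kappa>\<in>UNIV. \<Sum>\<tau>\<in>UNIV. gg \<kappa> \<tau> * pd \<kappa> (A [\<tau>, \<mu>, \<nu>]) x)"
  by (simp add: codiff_def codiff_chr1_def ginv1_at chr1_at numeral_3_eq_3 sum.distrib
      sum_subtractf algebra_simps)

lemma pd_extd_B:
  "pd \<alpha> (extd B [\<mu>, \<nu>, \<tau>]) x = pd \<alpha> (pd \<mu> (B [\<nu>, \<tau>])) x - pd \<alpha> (pd \<nu> (B [\<mu>, \<tau>])) x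
    + pd \<alpha> (pd \<tau> (B [\<mu>, \<nu>])) x"
  unfolding extd_2[abs_def] by (rule pd_eqI) (auto intro!: derivative_eq_intros has_pd_intros)

lemma pd_gauge_C:
  "pd \<rho> (gauge_C gb g B [\<nu>]) x = dgauge_C1 S \<rho> \<nu>
    - (\<Sum>\<kappa>\<in>UNIV. \<Sum>\<tau>\<in>UNIV. gg \<kappa> \<tau> * pd \<rho> (pd \<kappa> (B [\<tau>, \<nu>])) x)"
proof -
  have C: "gauge_C gb g B [\<nu>] = (\<lambda>y. - (\<Sum>\<kappa>\<in>UNIV. \<Sum>\<tau>\<in>UNIV. ginv g \<kappa> \<tau> y * (pd \<kappa> (B [\<tau>, \<nu>]) y -
      ((\<Sum>\<rho>\<in>UNIV. christoffel gb \<rho> \<kappa> \<tau> y * B [\<rho>, \<nu>] y) +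
       (\<Sum>\<rho>\<in>UNIV. christoffel gb \<rho> \<kappa> \<nu> y * B [\<tau>, \<rho>] y)))))"
    by (simp add: gauge_C_def fun_eq_iff numeral_2_eq_2)
  show ?thesis
    unfolding C
    by (rule pd_eqI) (auto intro!: derivative_eq_intros has_pd_intros
        simp: dgauge_C1_def ginv1_at dginv1_at sum.distrib sum_subtractf algebra_simps)
qed

text \<open>The divergence of the exterior derivative of \<open>B\<close> yields the wave operator
  and two terms with a free derivative index. These are the second-order terms of the exterior
  derivative of the gauge covector with opposite sign, up to the order of differentiation.\<close>

lemma box_Hd_hat_at:
  "box_Hd_hat gb g B [\<mu>, \<nu>] x = lhs1 S (B_comp \<mu> \<nu>) + wave_part g (B [\<mu>, \<nu>]) x"
proof -
  have comm: "pd \<alpha> (pd \<beta> (B [\<sigma>, \<tau>])) x = pd \<beta> (pd \<alpha> (B [\<sigma>, \<tau>])) x" for \<alpha> \<beta> \<sigma> \<tau>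
    by (rule pd_commute[OF open_U smooth_B x])
  have "extd_B1 S = (\<lambda>\<rho> \<mu> \<nu>. extd B [\<rho>, \<mu>, \<nu>] x)"
    by (simp add: fun_eq_iff extd_B1_def extd_2)
  then show ?thesis
    \<comment> \<open>The two instances of \<open>comm\<close> move the free indices
      \<open>\<mu>\<close> and \<open>\<nu>\<close> outwards, so that matching mixed derivatives
      cancel.\<close>
    by (simp add: box_Hd_hat_def codiff_3 extd_1 pd_gauge_C pd_extd_B wave_part_def
        comm[of _ \<mu>] comm[of _ \<nu>] sum.distrib sum_subtractf distrib_left right_diff_distrib)
qed

section \<open>Assembly of the component equations\<close>

lemma system_lhs_at:
  "system_lhs gb g B \<phi> k x = lhs1 S k + inverse (eq_const (- 2) 1 1 k) * wave_part g (u_comp g B \<phi> k) x"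
  by (cases k) (simp_all only: system_lhs.simps ricci_hat_at box_Hd_hat_at box_phi_at eq_const.simps
      u_comp.simps, simp_all)

lemma Hnorm_at: "Hnorm2 g (field_strength Hb B) x = Hnorm1 S"
  by (simp add: Hnorm2_def Hnorm1_def ginv1_at strength1_at)

lemma Hsq_at: "Hsq g (field_strength Hb B) \<mu> \<nu> x = Hsq1 S \<mu> \<nu>"
  by (simp add: Hsq_def Hsq1_def ginv1_at strength1_at)

lemma dilaton_at: "dilaton_factor \<phi> x = dilaton1 S"
  by (simp add: dilaton_factor_def dilaton1_def)

lemma system_rhs_at: "system_rhs Hb g B \<phi> k x = rhs1 S k"
proof (cases k)
  case (G_comp \<mu> \<nu>)
  then show ?thesis
    by (simp add: Hnorm_at Hsq_at dilaton_at extd_0)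
next
  case (B_comp \<mu> \<nu>)
  then show ?thesis
    by (simp add: codiff_3 interior_def strength1_at ginv1_at extd_0)
next
  case Phi_comp
  then show ?thesis
    by (simp add: Hnorm_at dilaton_at)
qed

lemma system_at:
  "eq_const (- 2) 1 1 k * (system_lhs gb g B \<phi> k x - system_rhs Hb g B \<phi> k x) =
    wave_part g (u_comp g B \<phi> k) x - nonlinearity S k"
  unfolding system_lhs_at system_rhs_at nonlinearity_def
  by (cases k) (simp_all add: algebra_simps)

end

end

section \<open>The system in a chart\<close>

text \<open>Allows the background functions to be numbered by an initial segment of the
  naturals.\<close>

lemma finite_UNIV_background: "finite (UNIV :: 'n::finite background set)"
proof -
  have "(UNIV :: 'n background set) =
      (\<lambda>(\<tau>, \<mu>, \<nu>). Conn \<tau> \<mu> \<nu>) ` UNIV \<union> (\<lambda>(\<mu>, \<nu>, \<tau>). Flux \<mu> \<nu> \<tau>) ` UNIV"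
    by (auto simp: image_iff) (metis background.exhaust)
  then show ?thesis by (metis finite_Un finite_code finite_imageI)
qed

lemma open_chart_image:
  assumes "is_chart M c" "openin M \<Omega>"
  shows "open (snd c ` (fst c \<inter> \<Omega>))"
proof -
  have "openin (subtopology M (fst c)) (fst c \<inter> \<Omega>)"
    using assms(2) by (auto simp: openin_subtopology_Int2)
  moreover have "open_map (subtopology M (fst c)) (top_of_set (snd c ` fst c)) (snd c)"
    using assms(1) homeomorphic_imp_open_map by (auto simp: is_chart_def)
  ultimately have "openin (top_of_set (snd c ` fst c)) (snd c ` (fst c \<inter> \<Omega>))"
    by (auto simp: open_map_def)
  then show ?thesis
    using assms(1) openin_open_trans by (auto simp: is_chart_def)
qed

lemma metric_on_chart:
  assumes "lorentzian_metric \<A> \<Omega> g" "c \<in> \<A>" "is_chart M c" "openin M \<Omega>"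
  shows "metric_on (snd c ` (fst c \<inter> \<Omega>)) (g c)"
  using assms open_chart_image[of M c \<Omega>]
  by unfold_locales (auto simp: lorentzian_metric_def tensor_field_def)

lemma smooth_on_subset: "smooth_on U h \<Longrightarrow> U' \<subseteq> U \<Longrightarrow> smooth_on U' h"
  unfolding smooth_on_def smooth_vars_on_def by blast

lemma C_inf_imp_smooth_vars_on: "C_inf W F \<Longrightarrow> A \<subseteq> W \<Longrightarrow> smooth_vars_on A F"
  unfolding smooth_vars_on_def C_inf_def by blast

text \<open>Here the background is evaluated at the coordinate point contained in \<open>v\<close>;
  in \<open>F_slots\<close> its derivatives are independent variables, and \<open>e\<close> numbers
  the background functions.\<close>

definition f_slots ::
  "'n::finite components \<Rightarrow> 'n components \<Rightarrow> ('n + 'n jet_var \<Rightarrow> real) \<Rightarrow> 'n slots" where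
  "f_slots gb Hb v = case_sum (\<lambda>y. v (Inr y))
     (\<lambda>(\<beta>, \<alpha>). pds \<alpha> (background_fun gb Hb \<beta>) (\<chi> i. v (Inl i)))"

definition F_slots ::
  "('n background \<Rightarrow> nat) \<Rightarrow> ('n jet_var + nat \<times> 'n list \<Rightarrow> real) \<Rightarrow> 'n slots" where
  "F_slots e v = case_sum (\<lambda>y. v (Inl y)) (\<lambda>(\<beta>, \<alpha>). v (Inr (e \<beta>, \<alpha>)))"

text \<open>The formula makes sense wherever the metric variables form an invertible matrix,
  symmetric or not; that open set carries the smooth extension off the Lorentzian matrices.\<close>

lemma smooth_nonlinearity_f_slots:
  assumes U: "open U" and bg: "\<And>\<beta>. smooth_on U (background_fun gb Hb \<beta>)"
  shows "smooth_vars_on (f_domain U) (\<lambda>v. nonlinearity (f_slots gb Hb v) k)"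
proof -
  let ?U = "{v :: 'a + 'a jet_var \<Rightarrow> real. (\<chi> i. v (Inl i)) \<in> U}"
  let ?det = "\<lambda>v. det (\<chi> \<alpha> \<beta>. v (Inr (Val (G_comp \<alpha> \<beta>))) :: real^'a^'a)"
  have comp: "C_inf ?U (\<lambda>v. pds \<alpha> (background_fun gb Hb \<beta>) (\<chi> i. v (Inl i)))" for \<alpha> \<beta>
    by (intro C_inf_smooth_on_Inl smooth_on_pds U bg)
  then have "open ?U" by (simp add: C_inf_def)
  then have "C_inf ?U ?det"
    by (intro C_inf_det) (simp_all add: C_inf_coord)
  then have W: "open {v \<in> ?U. ?det v \<noteq> 0}"
    by (rule open_C_inf_nonzero)
  have "C_inf {v \<in> ?U. ?det v \<noteq> 0} (\<lambda>v. f_slots gb Hb v z)" for z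
  proof (cases z)
    case (Inl y)
    then show ?thesis
      using C_inf_coord[OF W, of "Inr y"] by (simp add: f_slots_def)
  next
    case (Inr p)
    then show ?thesis
      using C_inf_subset[OF comp W, of "snd p" "fst p"] by (simp add: f_slots_def case_prod_beta subset_iff)
  qed
  then have "C_inf {v \<in> ?U. ?det v \<noteq> 0} (\<lambda>v. nonlinearity (f_slots gb Hb v) k)"
    by (rule C_inf_nonlinearity) (simp add: f_slots_def)
  then show ?thesis
    by (rule C_inf_imp_smooth_vars_on)
      (auto simp: f_domain_def dest: lorentzian_invertible simp flip: invertible_det_nz)
qed

lemma smooth_nonlinearity_F_slots:
  "smooth_vars_on F_domain (\<lambda>v. nonlinearity (F_slots e v :: 'n::finite slots) k)"
proof -
  let ?det = "\<lambda>v :: 'n jet_var + nat \<times> 'n list \<Rightarrow> real.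
    det (\<chi> \<alpha> \<beta>. v (Inl (Val (G_comp \<alpha> \<beta>))) :: real^'n^'n)"
  have "C_inf UNIV ?det"
    by (intro C_inf_det) (simp_all add: C_inf_coord)
  then have W: "open {v \<in> UNIV. ?det v \<noteq> 0}"
    by (rule open_C_inf_nonzero)
  have "C_inf {v \<in> UNIV. ?det v \<noteq> 0} (\<lambda>v. F_slots e v z)" for z
    by (cases z) (auto simp: F_slots_def intro!: C_inf_coord[OF W, simplified])
  then have "C_inf {v \<in> UNIV. ?det v \<noteq> 0} (\<lambda>v. nonlinearity (F_slots e v) k)"
    by (rule C_inf_nonlinearity) (simp add: F_slots_def)
  then show ?thesis
    by (rule C_inf_imp_smooth_vars_on)
      (auto simp: F_domain_def dest: lorentzian_invertible simp flip: invertible_det_nz)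
qed

text \<open>Background derivatives enter up to order one only, which bounds the multi-indices in the
  final statement.\<close>

lemma nonlinearity_cong:
  assumes "\<And>y. s (Inl y) = s' (Inl y)" "\<And>\<beta>. s (Inr (\<beta>, [])) = s' (Inr (\<beta>, []))"
    "\<And>\<alpha> \<beta>. s (Inr (\<beta>, [\<alpha>])) = s' (Inr (\<beta>, [\<alpha>]))"
  shows "nonlinearity s k = nonlinearity s' k"
  by (cases k) (simp_all add: nonlinearity_def first_order_defs ginv1_def assms)

text \<open>Converts the vanishing conditions on the background metric into vanishing of the
  connection slots: each term of the Christoffel symbols and of their first derivatives contains a
  first or second derivative of the metric.\<close>

lemma pd_christoffel_eq_0:
  assumes "metric_on U gb" "x \<in> U"
    and "\<And>\<alpha> \<mu> \<nu>. pd \<alpha> (gb [\<mu>, \<nu>]) x = 0" "\<And>\<alpha> \<beta> \<mu> \<nu>. pd \<alpha> (pd \<beta> (gb [\<mu>, \<nu>])) x = 0"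
  shows "christoffel gb \<tau> \<mu> \<nu> x = 0" "pd \<alpha> (christoffel gb \<tau> \<mu> \<nu>) x = 0"
proof -
  interpret metric_on U gb by fact
  show "christoffel gb \<tau> \<mu> \<nu> x = 0"
    by (simp add: christoffel_def assms)
  have "((\<lambda>t. christoffel gb \<tau> \<mu> \<nu> (x + t *\<^sub>R axis \<alpha> 1)) has_real_derivative 0) (at 0)"
    unfolding christoffel_def
    by (auto intro!: derivative_eq_intros smooth_on_has_pd[OF open_U _ assms(2)] smooth_ginv
        smooth_on_pd open_U smooth_metric simp: assms)
  then show "pd \<alpha> (christoffel gb \<tau> \<mu> \<nu>) x = 0"
    by (rule pd_eqI)
qed

theorem proposition5p12:
  fixes M :: "'m topology" and \<A> :: "('m, 'n::finite) chart set"
    and gb Hb :: "('m, 'n) chart \<Rightarrow> 'n components"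
  assumes dim: "CARD('n) \<ge> 3"
    and manifold: "smooth_manifold M \<A>"
    and background_metric: "lorentzian_metric \<A> (topspace M) gb"
    and background_form: "form_field \<A> (topspace M) 3 Hb"
    and background_closed:
      "\<And>c is x. c \<in> \<A> \<Longrightarrow> length is = 4 \<Longrightarrow> x \<in> snd c ` fst c \<Longrightarrow> extd (Hb c) is x = 0"
  shows "\<exists>aG aB aPhi. \<forall>c\<in>\<A>. \<exists>f.
    quasilinear_hyperbolic_form M \<A> c (gb c) (Hb c) (eq_const aG aB aPhi) f \<and>
    (\<forall>(g, B, \<phi>, x) \<in> chart_unknowns M \<A> c.
       (\<forall>\<alpha> \<mu> \<nu>. pd \<alpha> (g [\<mu>, \<nu>]) x = 0) \<and>
       (\<forall>\<mu> \<nu>. B [\<mu>, \<nu>] x = 0) \<and>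
       (\<forall>\<alpha> \<mu> \<nu>. pd \<alpha> (B [\<mu>, \<nu>]) x = 0) \<and>
       \<phi> [] x = 0 \<and>
       (\<forall>\<alpha>. pd \<alpha> (\<phi> []) x = 0) \<and>
       (\<forall>\<mu> \<nu> \<tau>. Hb c [\<mu>, \<nu>, \<tau>] x = 0) \<and>
       (\<forall>\<alpha> \<mu> \<nu> \<tau>. pd \<alpha> (Hb c [\<mu>, \<nu>, \<tau>]) x = 0) \<and>
       (\<forall>\<alpha> \<mu> \<nu>. pd \<alpha> (gb c [\<mu>, \<nu>]) x = 0) \<and>
       (\<forall>\<alpha> \<beta> \<mu> \<nu>. pd \<alpha> (pd \<beta> (gb c [\<mu>, \<nu>])) x = 0)
       \<longrightarrow> (\<forall>k. f (f_args g B \<phi> x) k = 0)) \<and>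
    (\<exists>(L::nat) (N::nat) b F.
       (\<forall>l<L. smooth_on (snd c ` fst c) (b l)) \<and>
       (\<forall>k. smooth_vars_on F_domain (\<lambda>v. F v k)) \<and>
       (\<forall>v w. (\<forall>y. v (Inl y) = w (Inl y)) \<and>
              (\<forall>l<L. \<forall>\<alpha>. length \<alpha> \<le> N \<longrightarrow> v (Inr (l, \<alpha>)) = w (Inr (l, \<alpha>)))
              \<longrightarrow> F v = F w) \<and>
       (\<forall>v\<in>F_domain. (\<forall>z. (\<nexists>\<mu> \<nu>. z = Inl (Val (G_comp \<mu> \<nu>))) \<longrightarrow> v z = 0)
              \<longrightarrow> (\<forall>k. F v k = 0)) \<and>
       (\<forall>(g, B, \<phi>, x) \<in> chart_unknowns M \<A> c. \<forall>k.
          f (f_args g B \<phi> x) k = F (F_args b g B \<phi> x) k))"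
proof (intro exI ballI)
  fix c assume c: "c \<in> \<A>"
  let ?U = "snd c ` fst c"
  let ?bg = "background_fun (gb c) (Hb c)"
  have chart: "is_chart M c" using manifold c by (auto simp: smooth_manifold_def)
  then have dom: "fst c \<inter> topspace M = fst c" and U: "open ?U"
    using openin_subset by (auto simp: is_chart_def)
  have gb: "metric_on ?U (gb c)"
    using metric_on_chart[OF background_metric c chart openin_topspace] by (simp add: dom)
  have flux: "smooth_on ?U (Hb c [\<mu>, \<nu>, \<tau>])" for \<mu> \<nu> \<tau>
    using background_form c dom by (auto simp: form_field_def tensor_field_def)
  have bg: "smooth_on ?U (?bg \<beta>)" for \<beta>
    by (cases \<beta>) (auto intro: metric_on.smooth_christoffel[OF gb] flux)
  \<comment> \<open>The number \<open>L\<close> of background functions and their numbering;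
    \<open>inv e\<close> recovers the label of a function from its index.\<close>
  obtain e :: "'n background \<Rightarrow> nat" and L where e: "bij_betw e UNIV {..<L}"
    using ex_bij_betw_finite_nat[OF finite_UNIV_background] by (auto simp: atLeast0LessThan)
  then have e_less: "e \<beta> < L" and inv_e: "inv e (e \<beta>) = \<beta>" for \<beta>
    by (auto simp: bij_betw_def)
  \<comment> \<open>Both functions are the same \<open>nonlinearity\<close> with differently filled
    slots. On actual fields both fillings reduce to \<open>slots_at\<close>, which gives the
    identity between \<open>f\<close> and \<open>F\<close>.\<close>
  let ?f = "\<lambda>v. nonlinearity (f_slots (gb c) (Hb c) v)"
  let ?F = "\<lambda>v. nonlinearity (F_slots e v)"
  have f_args: "f_slots (gb c) (Hb c) (f_args g B \<phi> x) = slots_at (gb c) (Hb c) g B \<phi> x" for g B \<phi> x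
    by (auto simp: f_slots_def f_args_def slots_at_def fun_eq_iff split: sum.splits)
  have F_args: "F_slots e (F_args (\<lambda>l. ?bg (inv e l)) g B \<phi> x) = slots_at (gb c) (Hb c) g B \<phi> x" for g B \<phi> x
    by (auto simp: F_slots_def F_args_def slots_at_def inv_e fun_eq_iff split: sum.splits)
  \<comment> \<open>The unknowns live on an open part of the manifold only, so the local computation
    takes place on the chart image of that part, with the background restricted to it.\<close>
  have sol: "\<exists>V\<subseteq>?U. x \<in> V \<and> solution_on V g (gb c) (Hb c) B \<phi>"
    if u: "(g, B, \<phi>, x) \<in> chart_unknowns M \<A> c" for g B \<phi> x
  proof -
    obtain g' B' \<phi>' \<Omega> where u: "g = g' c" "B = B' c" "\<phi> = \<phi>' c" "openin M \<Omega>"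
      "lorentzian_metric \<A> \<Omega> g'" "form_field \<A> \<Omega> 2 B'" "tensor_field \<A> \<Omega> 0 \<phi>'"
      "x \<in> snd c ` (fst c \<inter> \<Omega>)"
      using u by (auto simp: chart_unknowns_def)
    let ?V = "snd c ` (fst c \<inter> \<Omega>)"
    have "?V \<subseteq> ?U" by blast
    interpret metric_on ?V g
      unfolding u(1) by (rule metric_on_chart[OF u(5) c chart u(4)])
    have "solution_on ?V g (gb c) (Hb c) B \<phi>"
      using u c metric_on.smooth_christoffel[OF gb] flux smooth_on_subset[OF _ \<open>?V \<subseteq> ?U\<close>]
      by unfold_locales (auto simp: form_field_def tensor_field_def)
    then show ?thesis using \<open>?V \<subseteq> ?U\<close> u(8) by blast
  qed
  \<comment> \<open>The constants \<open>-2\<close>, \<open>1\<close>, \<open>1\<close> are the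
    reciprocals of the coefficients of the wave operator in the three kinds of equations and are
    common to all charts.\<close>
  show "quasilinear_hyperbolic_form M \<A> c (gb c) (Hb c) (eq_const (- 2) 1 1) ?f \<and>
    (\<forall>(g, B, \<phi>, x) \<in> chart_unknowns M \<A> c.
       (\<forall>\<alpha> \<mu> \<nu>. pd \<alpha> (g [\<mu>, \<nu>]) x = 0) \<and>
       (\<forall>\<mu> \<nu>. B [\<mu>, \<nu>] x = 0) \<and>
       (\<forall>\<alpha> \<mu> \<nu>. pd \<alpha> (B [\<mu>, \<nu>]) x = 0) \<and>
       \<phi> [] x = 0 \<and>
       (\<forall>\<alpha>. pd \<alpha> (\<phi> []) x = 0) \<and>
       (\<forall>\<mu> \<nu> \<tau>. Hb c [\<mu>, \<nu>, \<tau>] x = 0) \<and>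
       (\<forall>\<alpha> \<mu> \<nu> \<tau>. pd \<alpha> (Hb c [\<mu>, \<nu>, \<tau>]) x = 0) \<and>
       (\<forall>\<alpha> \<mu> \<nu>. pd \<alpha> (gb c [\<mu>, \<nu>]) x = 0) \<and>
       (\<forall>\<alpha> \<beta> \<mu> \<nu>. pd \<alpha> (pd \<beta> (gb c [\<mu>, \<nu>])) x = 0)
       \<longrightarrow> (\<forall>k. ?f (f_args g B \<phi> x) k = 0)) \<and>
    (\<exists>(L::nat) (N::nat) b F.
       (\<forall>l<L. smooth_on (snd c ` fst c) (b l)) \<and>
       (\<forall>k. smooth_vars_on F_domain (\<lambda>v. F v k)) \<and>
       (\<forall>v w. (\<forall>y. v (Inl y) = w (Inl y)) \<and>
              (\<forall>l<L. \<forall>\<alpha>. length \<alpha> \<le> N \<longrightarrow> v (Inr (l, \<alpha>)) = w (Inr (l, \<alpha>)))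
              \<longrightarrow> F v = F w) \<and>
       (\<forall>v\<in>F_domain. (\<forall>z. (\<nexists>\<mu> \<nu>. z = Inl (Val (G_comp \<mu> \<nu>))) \<longrightarrow> v z = 0)
              \<longrightarrow> (\<forall>k. F v k = 0)) \<and>
       (\<forall>(g, B, \<phi>, x) \<in> chart_unknowns M \<A> c. \<forall>k.
          ?f (f_args g B \<phi> x) k = F (F_args b g B \<phi> x) k))"
  proof (intro conjI)
    show "quasilinear_hyperbolic_form M \<A> c (gb c) (Hb c) (eq_const (- 2) 1 1) ?f"
      unfolding quasilinear_hyperbolic_form_def
    proof (intro conjI allI)
      show "eq_const (- 2) 1 1 k \<noteq> 0" for k :: "'n unknown"
        by (cases k) auto
      show "smooth_vars_on (f_domain ?U) (\<lambda>v. ?f v k)" for k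
        by (rule smooth_nonlinearity_f_slots[OF U bg])
      have "lorentzian (\<chi> \<mu> \<nu>. ginv g \<mu> \<nu> x) \<and>
          (\<forall>k. eq_const (- 2) 1 1 k * (system_lhs (gb c) g B \<phi> k x - system_rhs (Hb c) g B \<phi> k x) =
            wave_part g (u_comp g B \<phi> k) x - ?f (f_args g B \<phi> x) k)"
        if u: "(g, B, \<phi>, x) \<in> chart_unknowns M \<A> c" for g B \<phi> x
      proof -
        obtain V where V: "x \<in> V" and "solution_on V g (gb c) (Hb c) B \<phi>"
          using sol[OF u] by blast
        then interpret solution_on V g "gb c" "Hb c" B \<phi> by simp
        have "(\<chi> \<mu> \<nu>. ginv g \<mu> \<nu> x) = matrix_inv (gmat g x)"
          by (simp add: ginv_def vec_eq_iff)
        then show ?thesis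
          by (simp add: lorentzian_matrix_inv lorentzian_metric[OF V] system_at[OF V] f_args)
      qed
      then show "\<forall>(g, B, \<phi>, x)\<in>chart_unknowns M \<A> c. lorentzian (\<chi> \<mu> \<nu>. ginv g \<mu> \<nu> x) \<and>
          (\<forall>k. eq_const (- 2) 1 1 k * (system_lhs (gb c) g B \<phi> k x - system_rhs (Hb c) g B \<phi> k x) =
            wave_part g (u_comp g B \<phi> k) x - ?f (f_args g B \<phi> x) k)"
        by blast
    qed
  next
    show "\<forall>(g, B, \<phi>, x) \<in> chart_unknowns M \<A> c.
       (\<forall>\<alpha> \<mu> \<nu>. pd \<alpha> (g [\<mu>, \<nu>]) x = 0) \<and>
       (\<forall>\<mu> \<nu>. B [\<mu>, \<nu>] x = 0) \<and>
       (\<forall>\<alpha> \<mu> \<nu>. pd \<alpha> (B [\<mu>, \<nu>]) x = 0) \<and>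
       \<phi> [] x = 0 \<and>
       (\<forall>\<alpha>. pd \<alpha> (\<phi> []) x = 0) \<and>
       (\<forall>\<mu> \<nu> \<tau>. Hb c [\<mu>, \<nu>, \<tau>] x = 0) \<and>
       (\<forall>\<alpha> \<mu> \<nu> \<tau>. pd \<alpha> (Hb c [\<mu>, \<nu>, \<tau>]) x = 0) \<and>
       (\<forall>\<alpha> \<mu> \<nu>. pd \<alpha> (gb c [\<mu>, \<nu>]) x = 0) \<and>
       (\<forall>\<alpha> \<beta> \<mu> \<nu>. pd \<alpha> (pd \<beta> (gb c [\<mu>, \<nu>])) x = 0)
       \<longrightarrow> (\<forall>k. ?f (f_args g B \<phi> x) k = 0)"
    proof (clarify, unfold f_args)
      fix g B \<phi> x k
      assume u: "(g, B, \<phi>, x) \<in> chart_unknowns M \<A> c"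
        and 0: "\<forall>\<alpha> \<mu> \<nu>. pd \<alpha> (g [\<mu>, \<nu>]) x = 0" "\<forall>\<mu> \<nu>. B [\<mu>, \<nu>] x = 0"
        "\<forall>\<alpha> \<mu> \<nu>. pd \<alpha> (B [\<mu>, \<nu>]) x = 0" "\<forall>\<alpha>. pd \<alpha> (\<phi> []) x = 0"
        "\<forall>\<mu> \<nu> \<tau>. Hb c [\<mu>, \<nu>, \<tau>] x = 0" "\<forall>\<alpha> \<mu> \<nu> \<tau>. pd \<alpha> (Hb c [\<mu>, \<nu>, \<tau>]) x = 0"
        and gb0: "\<forall>\<alpha> \<mu> \<nu>. pd \<alpha> (gb c [\<mu>, \<nu>]) x = 0"
        "\<forall>\<alpha> \<beta> \<mu> \<nu>. pd \<alpha> (pd \<beta> (gb c [\<mu>, \<nu>])) x = 0"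
      have "x \<in> ?U" using sol[OF u] by blast
      \<comment> \<open>Flux slots vanish by assumption, connection slots by
        \<open>pd_christoffel_eq_0\<close>.\<close>
      then have "?bg \<beta> x = 0" "pd \<alpha> (?bg \<beta>) x = 0" for \<alpha> \<beta>
        using 0 pd_christoffel_eq_0[OF gb \<open>x \<in> ?U\<close>] gb0 by (cases \<beta>; simp)+
      with 0 show "nonlinearity (slots_at (gb c) (Hb c) g B \<phi> x) k = 0"
        by (intro nonlinearity_eq_0) simp_all
    qed
  next
    show "\<exists>(L::nat) (N::nat) b F.
       (\<forall>l<L. smooth_on (snd c ` fst c) (b l)) \<and>
       (\<forall>k. smooth_vars_on F_domain (\<lambda>v. F v k)) \<and>
       (\<forall>v w. (\<forall>y. v (Inl y) = w (Inl y)) \<and>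
              (\<forall>l<L. \<forall>\<alpha>. length \<alpha> \<le> N \<longrightarrow> v (Inr (l, \<alpha>)) = w (Inr (l, \<alpha>)))
              \<longrightarrow> F v = F w) \<and>
       (\<forall>v\<in>F_domain. (\<forall>z. (\<nexists>\<mu> \<nu>. z = Inl (Val (G_comp \<mu> \<nu>))) \<longrightarrow> v z = 0)
              \<longrightarrow> (\<forall>k. F v k = 0)) \<and>
       (\<forall>(g, B, \<phi>, x) \<in> chart_unknowns M \<A> c. \<forall>k.
          ?f (f_args g B \<phi> x) k = F (F_args b g B \<phi> x) k)"
    \<comment> \<open>Order one suffices for \<open>N\<close>: the second derivatives of the
      background metric are first derivatives of its Christoffel symbols, which serve as background
      functions.\<close>
    proof (rule exI[of _ L], rule exI[of _ 1], rule exI[of _ "\<lambda>l. ?bg (inv e l)"], rule exI[of _ ?F],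
        intro conjI allI impI ballI)
      show "smooth_on ?U (?bg (inv e l))" for l by (rule bg)
      show "smooth_vars_on F_domain (\<lambda>v. ?F v k)" for k by (rule smooth_nonlinearity_F_slots)
      show "?F v = ?F w" if "(\<forall>y. v (Inl y) = w (Inl y)) \<and>
          (\<forall>l<L. \<forall>\<alpha>. length \<alpha> \<le> 1 \<longrightarrow> v (Inr (l, \<alpha>)) = w (Inr (l, \<alpha>)))" for v w
      proof
        show "?F v k = ?F w k" for k
          by (rule nonlinearity_cong) (use that e_less in \<open>simp_all add: F_slots_def\<close>)
      qed
      show "?F v k = 0" if "\<forall>z. (\<nexists>\<mu> \<nu>. z = Inl (Val (G_comp \<mu> \<nu>))) \<longrightarrow> v z = 0" for v k
        by (rule nonlinearity_eq_0) (use that in \<open>simp_all add: F_slots_def\<close>)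
      show "case z of (g, B, \<phi>, x) \<Rightarrow> \<forall>k. ?f (f_args g B \<phi> x) k =
          ?F (F_args (\<lambda>l. ?bg (inv e l)) g B \<phi> x) k" for z
        by (simp add: f_args F_args split: prod.splits)
    qed
  qed
qed

end
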